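(* Let $N\ge1$, $\tau\in\mathbb C$ with $\mathrm{Im}\,\tau>0$, $n\ge3$, and let $a$ be a fixed index with $1\le a\le n$. Let $R^{\hbar}_{ij}=R^{\mathrm{ACF}}_{ij}(\hbar,z_i,z_j|\,u)$ for $1\le i\ne j\le n$, where $R^{\mathrm{ACF}}$ is the elliptic Arutyunov–Chekhov–Frolov $R$-matrix defined in the context. Then, as an identity of meromorphic functions of $\hbar,z_1,\dots,z_n,u_1,\dots,u_N$ with values in $\mathrm{Mat}(N,\mathbb C)^{\otimes n}$, $$\sum_{(i_1,\dots,i_{n-1})}R^{\hbar}_{a\,i_1}\,R^{\hbar}_{i_1i_2}\cdots R^{\hbar}_{i_{n-2}i_{n-1}}\,R^{\hbar}_{i_{n-1}a}=(-1)^n\left.\frac{d^{\,n-2}\wp(\eta)}{d\eta^{\,n-2}}\right|_{\eta=\hbar}\;1^{\otimes n},$$ where the sum runs over all tuples $(i_1,\dots,i_{n-1})$ of pairwise distinct elements of $\{1,\dots,n\}\setminus\{a\}$.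
   Context: Theta functions with characteristics: $\theta\left[{a\atop b}\right](z|\tau)=\sum_{j\in\mathbb Z}\exp\left(\pi\imath\tau(j+a)^2+2\pi\imath(j+a)(z+b)\right)$; $\vartheta(z)=\theta\left[{1/2\atop 1/2}\right](z|\tau)$. Kronecker function $\phi(\eta,z)=\dfrac{\vartheta'(0)\vartheta(\eta+z)}{\vartheta(\eta)\vartheta(z)}$; first Eisenstein function $E_1(z)=\vartheta'(z)/\vartheta(z)$; Weierstrass function $\wp(z)=-\partial_zE_1(z)+\frac13\frac{\vartheta'''(0)}{\vartheta'(0)}$. $E_{ij}$ is the standard matrix-unit basis of $\mathrm{Mat}(N,\mathbb C)$, $u=(u_1,\dots,u_N)$ and $u_{ij}=u_i-u_j$. The ACF $R$-matrix is $$R^{\mathrm{ACF}}_{12}(\hbar,z_1,z_2|\,u)=\sum_{i\ne j}E_{ii}\otimes E_{jj}\,\phi(\hbar,-u_{ij})+\sum_{i\ne j}E_{ij}\otimes E_{ji}\,\phi(z_1-z_2,-u_{ij})-\sum_{i\ne j}E_{ij}\otimes E_{jj}\,\phi(z_1+\hbar,-u_{ij})+\sum_{i\ne j}E_{jj}\otimes E_{ij}\,\phi(z_2,-u_{ij})+\bigl(E_1(\hbar)+E_1(z_1-z_2)+E_1(z_2)-E_1(z_1+\hbar)\bigr)\sum_iE_{ii}\otimes E_{ii}.$$ For $a\ne b$ in $\{1,\dots,n\}$, $R^{\mathrm{ACF}}_{ab}(\hbar,z_a,z_b|\,u)\in\mathrm{Mat}(N,\mathbb C)^{\otimes n}$ is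 obtained from $R^{\mathrm{ACF}}_{12}(\hbar,z_a,z_b|\,u)$ (i.e. with $z_1,z_2$ replaced by $z_a,z_b$) by placing its first tensor factor in position $a$ and its second tensor factor in position $b$, with identities in all other positions. *)

theory Defs
  imports "HOL-Complex_Analysis.Complex_Analysis"
begin

definition theta_char :: "complex \<Rightarrow> complex \<Rightarrow> complex \<Rightarrow> complex \<Rightarrow> complex" where
  "theta_char a b \<tau> z =
     (\<Sum>\<^sub>\<infinity>j\<in>(UNIV :: int set).
        exp (of_real pi * \<i> * \<tau> * (of_int j + a)^2
             + 2 * of_real pi * \<i> * (of_int j + a) * (z + b)))"

definition vartheta :: "complex \<Rightarrow> complex \<Rightarrow> complex" where
  "vartheta \<tau> z = theta_char (1/2) (1/2) \<tau> z"

definition kronecker_phi :: "complex \<Rightarrow> complex \<Rightarrow> complex \<Rightarrow> complex" where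
  "kronecker_phi \<tau> \<eta> z =
     deriv (vartheta \<tau>) 0 * vartheta \<tau> (\<eta> + z) / (vartheta \<tau> \<eta> * vartheta \<tau> z)"

definition eisenstein_E1 :: "complex \<Rightarrow> complex \<Rightarrow> complex" where
  "eisenstein_E1 \<tau> z = deriv (vartheta \<tau>) z / vartheta \<tau> z"

definition weierstrass_wp :: "complex \<Rightarrow> complex \<Rightarrow> complex" where
  "weierstrass_wp \<tau> z =
     - deriv (eisenstein_E1 \<tau>) z
     + 1/3 * ((deriv ^^ 3) (vartheta \<tau>) 0 / deriv (vartheta \<tau>) 0)"

definition matrix_unit :: "'k \<Rightarrow> 'k \<Rightarrow> complex^'k^'k" where
  "matrix_unit i j = (\<chi> p q. if p = i \<and> q = j then 1 else 0)"

text \<open>Scalar multiplication of a matrix by a complex number; the library operation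
  \<^term>\<open>c *s v\<close> multiplies by an element of the component type, which for a matrix
  is the type of its rows.\<close>

definition matrix_scale :: "complex \<Rightarrow> complex^'p^'q \<Rightarrow> complex^'p^'q" (infixr "*\<^sub>m" 75) where
  "c *\<^sub>m A = (\<chi> p q. c * A $ p $ q)"

definition kronecker_prod ::
    "complex^'k^'k \<Rightarrow> complex^'l^'l \<Rightarrow> complex^('k \<times> 'l)^('k \<times> 'l)" (infixr "\<otimes>\<^sub>K" 78) where
  "A \<otimes>\<^sub>K B = (\<chi> p q. A $ fst p $ fst q * B $ snd p $ snd q)"

definition R_ACF ::
    "complex \<Rightarrow> complex \<Rightarrow> complex \<Rightarrow> complex \<Rightarrow> complex^'k \<Rightarrow> complex^('k \<times> 'k)^('k \<times> 'k)" where
  "R_ACF \<tau> h z1 z2 u =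
     (\<Sum>(i, j)\<in>{(i, j). i \<noteq> j}.
        kronecker_phi \<tau> h (- (u $ i - u $ j)) *\<^sub>m (matrix_unit i i \<otimes>\<^sub>K matrix_unit j j))
   + (\<Sum>(i, j)\<in>{(i, j). i \<noteq> j}.
        kronecker_phi \<tau> (z1 - z2) (- (u $ i - u $ j)) *\<^sub>m (matrix_unit i j \<otimes>\<^sub>K matrix_unit j i))
   - (\<Sum>(i, j)\<in>{(i, j). i \<noteq> j}.
        kronecker_phi \<tau> (z1 + h) (- (u $ i - u $ j)) *\<^sub>m (matrix_unit i j \<otimes>\<^sub>K matrix_unit j j))
   + (\<Sum>(i, j)\<in>{(i, j). i \<noteq> j}.
        kronecker_phi \<tau> z2 (- (u $ i - u $ j)) *\<^sub>m (matrix_unit j j \<otimes>\<^sub>K matrix_unit i j))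
   + (eisenstein_E1 \<tau> h + eisenstein_E1 \<tau> (z1 - z2)
      + eisenstein_E1 \<tau> z2 - eisenstein_E1 \<tau> (z1 + h)) *\<^sub>m
       (\<Sum>i\<in>UNIV. matrix_unit i i \<otimes>\<^sub>K matrix_unit i i)"

text \<open>The tensor positions \<open>1, \<dots>, n\<close> are the elements of a finite type \<^typ>\<open>'n\<close>.
  The algebra $\mathrm{Mat}(N,\mathbb{C})^{\otimes n}$ is the algebra of matrices whose rows and
  columns are indexed by multi-indices, i.e. functions from positions to \<^typ>\<open>'k\<close>
  with \<open>N = CARD('k)\<close>; the unit $1^{\otimes n}$ is \<^term>\<open>mat 1\<close>.  The following linear
  map sends $A \otimes B$ to $A$ in position \<open>a\<close> and $B$ in position \<open>b\<close> (for \<open>a \<noteq> b\<close>),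
  with identities elsewhere.\<close>

definition place2 ::
    "'n \<Rightarrow> 'n \<Rightarrow> complex^('k \<times> 'k)^('k \<times> 'k)
       \<Rightarrow> complex^('n::finite \<Rightarrow> 'k::finite)^('n \<Rightarrow> 'k)" where
  "place2 a b M =
     (\<chi> p q. M $ (p a, p b) $ (q a, q b)
        * (\<Prod>c\<in>UNIV - {a, b}. (mat 1 :: complex^'k^'k) $ p c $ q c))"

definition R_ACF_at ::
    "complex \<Rightarrow> complex \<Rightarrow> complex^'n \<Rightarrow> complex^'k \<Rightarrow> 'n \<Rightarrow> 'n
       \<Rightarrow> complex^('n::finite \<Rightarrow> 'k::finite)^('n \<Rightarrow> 'k)" where
  "R_ACF_at \<tau> h z u a b = place2 a b (R_ACF \<tau> h (z $ a) (z $ b) u)"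

text \<open>\<open>path_prod R [i\<^sub>0, i\<^sub>1, \<dots>, i\<^sub>m]\<close> is the ordered matrix product
  \<open>R i\<^sub>0 i\<^sub>1 ** R i\<^sub>1 i\<^sub>2 ** \<dots> ** R i\<^sub>m\<^sub>-\<^sub>1 i\<^sub>m\<close>.\<close>

fun path_prod :: "('n \<Rightarrow> 'n \<Rightarrow> complex^'m^'m) \<Rightarrow> 'n list \<Rightarrow> complex^'m^'m" where
  "path_prod R (i # j # is) = R i j ** path_prod R (j # is)"
| "path_prod R _ = mat 1"

text \<open>Points \<open>(h, z, u)\<close> at which no denominator occurring in any of the matrices
  \<^term>\<open>R_ACF_at \<tau> h z u a b\<close> (\<open>a \<noteq> b\<close>) vanishes, i.e. the complement of the polar divisor.\<close>

definition R_ACF_regular :: "complex \<Rightarrow> complex \<Rightarrow> complex^'n \<Rightarrow> complex^'k \<Rightarrow> bool" where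
  "R_ACF_regular \<tau> h z u \<longleftrightarrow>
     vartheta \<tau> h \<noteq> 0
   \<and> (\<forall>c. vartheta \<tau> (z $ c) \<noteq> 0 \<and> vartheta \<tau> (z $ c + h) \<noteq> 0)
   \<and> (\<forall>c d. c \<noteq> d \<longrightarrow> vartheta \<tau> (z $ c - z $ d) \<noteq> 0)
   \<and> (\<forall>i j. i \<noteq> j \<longrightarrow> vartheta \<tau> (u $ i - u $ j) \<noteq> 0)"

end

theory Submission
  imports Defs
begin

text \<open>
  On functions of multi-indices, \<open>R\<^sub>a\<^sub>b\<close> acts in the two variables \<open>i = p a\<close>, \<open>j = p b\<close> with
  coefficients that are Kronecker functions of \<open>u\<^sub>j - u\<^sub>i\<close>.  In this form the Fay identity yields a
  degenerate associative Yang-Baxter equation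
  \<open>R\<^sub>x\<^sub>c R\<^sub>c\<^sub>y = R\<^sub>x\<^sub>y r\<^sub>x\<^sub>c + r\<^sub>c\<^sub>y R\<^sub>x\<^sub>y - D R\<^sub>x\<^sub>y\<close>, where \<open>r\<close> is skew-symmetric and does not depend on
  \<open>\<hbar>\<close>, and \<open>D = \<partial>\<^sub>\<hbar> - \<Sum>\<^sub>a \<partial>\<^sub>z\<^sub>a\<close>.  Insert a new index \<open>c\<close> into every edge of a closed path
  with product \<open>P\<close>.  Each \<open>r\<^sub>c\<^sub>v\<close> commutes with the factors of \<open>P\<close> that do not involve \<open>v\<close>, so it can
  be moved to an end of \<open>P\<close>, and the two terms at the base point \<open>a\<close> cancel by skew-symmetry;
  what remains is the commutator of \<open>\<Sum>\<^sub>v r\<^sub>c\<^sub>v\<close> with \<open>P\<close>, minus \<open>D P\<close>.  Summed over all orderings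
  of the other indices the commutator vanishes by induction, because the cyclic sum is scalar.  Hence each
  further index applies \<open>-D\<close> to the cyclic sum, and the start is unitarity,
  \<open>R\<^sub>a\<^sub>b R\<^sub>b\<^sub>a = \<wp>(\<hbar>) - \<wp>(z\<^sub>a - z\<^sub>b)\<close>, on which \<open>D\<close> acts as \<open>d/d\<hbar>\<close>.
\<close>

section \<open>The theta function\<close>

lemma summable_on_exp_minus_abs_int: "(\<lambda>j::int. exp (- \<bar>real_of_int j\<bar>)) summable_on UNIV"
proof -
  have geo: "summable (\<lambda>n. norm (exp (-1 :: real) ^ n))"
    by (simp add: summable_geometric)
  have nat: "(\<lambda>n::nat. exp (- real n)) summable_on UNIV"
    using norm_summable_imp_summable_on[OF geo] by (simp add: exp_of_nat_mult[symmetric])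
  have "(\<lambda>j::int. exp (- \<bar>real_of_int j\<bar>)) summable_on range int"
    by (subst summable_on_reindex) (use nat in \<open>auto simp: o_def\<close>)
  moreover have "(\<lambda>j::int. exp (- \<bar>real_of_int j\<bar>)) summable_on range (\<lambda>n. - int n)"
    by (subst summable_on_reindex) (use nat in \<open>auto simp: o_def inj_def\<close>)
  ultimately have "(\<lambda>j::int. exp (- \<bar>real_of_int j\<bar>)) summable_on (range int \<union> range (\<lambda>n. - int n))"
    by (rule summable_on_union)
  also have "range int \<union> range (\<lambda>n. - int n) = UNIV"
    by (auto simp: image_iff) (metis int_cases2)
  finally show ?thesis .
qed

text \<open>Completing the square: with x = |j| and s = -Re \<alpha> the exponent has real part at
  most ((r + 1) x - s x^2) - x, and the bracket is at most (r + 1)^2 / (4 s). Only r enters the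
  bound, as the M-test requires.\<close>

lemma norm_gauss_exp_le:
  fixes \<alpha> \<beta> :: complex and j :: int
  assumes "Re \<alpha> < 0" "norm \<beta> \<le> r"
  shows "norm (exp (\<alpha> * of_int j ^ 2 + \<beta> * of_int j))
           \<le> exp ((r + 1)\<^sup>2 / (- 4 * Re \<alpha>)) * exp (- \<bar>real_of_int j\<bar>)"
proof -
  define x s where "x = \<bar>real_of_int j\<bar>" and "s = - Re \<alpha>"
  have s: "s > 0" using assms by (simp add: s_def)
  have "Re (\<beta> * of_int j) \<le> norm (\<beta> * of_int j)"
    by (rule complex_Re_le_cmod)
  also have "\<dots> \<le> r * x"
    using assms(2) by (simp add: norm_mult x_def mult_right_mono)
  finally have 1: "Re (\<beta> * of_int j) \<le> r * x" .
  have 2: "Re (\<alpha> * of_int j ^ 2) = - s * x\<^sup>2"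
    by (simp add: s_def x_def power2_eq_square)
  have "0 \<le> (2 * s * x - (r + 1))\<^sup>2" by simp
  then have "4 * s * ((r + 1) * x - s * x\<^sup>2) \<le> (r + 1)\<^sup>2"
    by (simp add: power2_eq_square algebra_simps)
  then have 3: "(r + 1) * x - s * x\<^sup>2 \<le> (r + 1)\<^sup>2 / (4 * s)"
    using s by (simp add: field_simps)
  have "Re (\<alpha> * of_int j ^ 2 + \<beta> * of_int j) \<le> (r + 1)\<^sup>2 / (4 * s) - x"
    using 1 2 3 by (simp add: algebra_simps)
  then show ?thesis
    by (simp add: x_def s_def flip: exp_add)
qed

lemma gauss_exp_abs_summable:
  fixes \<alpha> \<beta> :: complex
  assumes "Re \<alpha> < 0"
  shows "(\<lambda>j::int. norm (exp (\<alpha> * of_int j ^ 2 + \<beta> * of_int j))) summable_on A"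
proof (rule Infinite_Sum.abs_summable_on_comparison_test')
  show "(\<lambda>j::int. exp ((norm \<beta> + 1)\<^sup>2 / (- 4 * Re \<alpha>)) * exp (- \<bar>real_of_int j\<bar>)) summable_on A"
    by (intro summable_on_cmult_right summable_on_subset_banach[OF summable_on_exp_minus_abs_int]) auto
qed (rule norm_gauss_exp_le[OF assms order_refl])

text \<open>The finite partial sums are entire and, by \<open>norm_gauss_exp_le\<close>, converge
  uniformly on every ball.\<close>

lemma gauss_exp_holomorphic:
  fixes \<alpha> :: complex
  assumes "Re \<alpha> < 0"
  shows "(\<lambda>\<beta>. \<Sum>\<^sub>\<infinity>j\<in>(UNIV::int set). exp (\<alpha> * of_int j ^ 2 + \<beta> * of_int j)) holomorphic_on UNIV"
proof (rule holomorphic_on_balls_imp_entire')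
  fix r :: real
  let ?f = "\<lambda>X \<beta>. \<Sum>j\<in>X. exp (\<alpha> * of_int j ^ 2 + \<beta> * of_int (j::int))"
  let ?F = "\<lambda>\<beta>. \<Sum>\<^sub>\<infinity>j\<in>(UNIV::int set). exp (\<alpha> * of_int j ^ 2 + \<beta> * of_int j)"
  have "uniform_limit (cball 0 r) ?f ?F (finite_subsets_at_top UNIV)"
  proof (rule Weierstrass_m_test_general)
    show "(\<lambda>j::int. exp ((r + 1)\<^sup>2 / (- 4 * Re \<alpha>)) * exp (- \<bar>real_of_int j\<bar>)) summable_on UNIV"
      by (intro summable_on_cmult_right summable_on_exp_minus_abs_int)
  qed (use norm_gauss_exp_le[OF assms] in auto)
  moreover have "\<forall>\<^sub>F X in finite_subsets_at_top UNIV.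
      continuous_on (cball 0 r) (?f X) \<and> ?f X holomorphic_on ball 0 r"
    by (intro always_eventually allI conjI continuous_intros holomorphic_intros)
  ultimately show "?F holomorphic_on ball 0 r"
    using holomorphic_uniform_limit[where F = "finite_subsets_at_top UNIV"] by force
qed

text \<open>Puts \<open>z\<close> into an exponential prefactor and the linear coefficient, so that
  holomorphy follows by composition with an affine map.\<close>

lemma vartheta_eq_gauss:
  "vartheta \<tau> z = exp (of_real pi * \<i> * \<tau> / 4 + of_real pi * \<i> * (z + 1/2)) *
     (\<Sum>\<^sub>\<infinity>j\<in>(UNIV::int set). exp (of_real pi * \<i> * \<tau> * of_int j ^ 2
        + (of_real pi * \<i> * \<tau> + 2 * of_real pi * \<i> * (z + 1/2)) * of_int j))"
  unfolding vartheta_def theta_char_def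
  by (subst infsum_cmult_right'[symmetric], rule infsum_cong)
     (simp add: algebra_simps power2_eq_square flip: exp_add)

lemma vartheta_holomorphic:
  assumes "Im \<tau> > 0"
  shows "vartheta \<tau> holomorphic_on A"
proof -
  have "(\<lambda>\<beta>. \<Sum>\<^sub>\<infinity>j\<in>(UNIV::int set). exp (of_real pi * \<i> * \<tau> * of_int j ^ 2 + \<beta> * of_int j)) holomorphic_on UNIV"
    using assms by (intro gauss_exp_holomorphic) simp
  from holomorphic_on_compose_gen[OF _ this,
      of "\<lambda>z. of_real pi * \<i> * \<tau> + 2 * of_real pi * \<i> * (z + 1/2)" A]
  have "(\<lambda>z. \<Sum>\<^sub>\<infinity>j\<in>(UNIV::int set). exp (of_real pi * \<i> * \<tau> * of_int j ^ 2
        + (of_real pi * \<i> * \<tau> + 2 * of_real pi * \<i> * (z + 1/2)) * of_int j)) holomorphic_on A"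
    by (simp add: o_def holomorphic_intros)
  then show ?thesis
    unfolding vartheta_eq_gauss[abs_def] by (intro holomorphic_intros)
qed

lemma infsum_product:
  fixes f :: "'a \<Rightarrow> complex" and g :: "'b \<Rightarrow> complex"
  assumes "(\<lambda>x. norm (f x)) summable_on A" "(\<lambda>y. norm (g y)) summable_on B"
  shows "(\<lambda>(x, y). f x * g y) summable_on A \<times> B"
    and "infsum f A * infsum g B = (\<Sum>\<^sub>\<infinity>(x, y)\<in>A \<times> B. f x * g y)"
proof -
  have "(\<lambda>p. norm (case p of (x, y) \<Rightarrow> f x * g y)) summable_on A \<times> B"
    unfolding Infinite_Sum.abs_summable_on_Sigma_iff
    using assms infsum_nonneg[of B "\<lambda>y. norm (g y)"]
    by (auto simp: norm_mult infsum_cmult_right' abs_mult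
        intro: summable_on_cmult_right summable_on_cmult_left)
  then show *: "(\<lambda>(x, y). f x * g y) summable_on A \<times> B"
    by (rule Infinite_Sum.abs_summable_summable)
  show "infsum f A * infsum g B = (\<Sum>\<^sub>\<infinity>(x, y)\<in>A \<times> B. f x * g y)"
    using infsum_Sigma'_banach[OF *]
    by (simp add: infsum_cmult_right' infsum_cmult_left')
qed

text \<open>Over the even or odd integers this is the theta function of modulus 2 \<tau> at 2 x,
  with b = 0 and a = 0 or a = 1/2 respectively.\<close>

definition theta_half :: "int set \<Rightarrow> complex \<Rightarrow> complex \<Rightarrow> complex" where
  "theta_half M \<tau> x =
     (\<Sum>\<^sub>\<infinity>m\<in>M. exp (of_real pi * \<i> * \<tau> / 2 * of_int m ^ 2 + 2 * of_real pi * \<i> * x * of_int m))"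

lemma exp_pi_i_of_int:
  "exp (of_real pi * \<i> * of_int m) = (if even m then 1 else - 1 :: complex)"
proof -
  have "exp (of_real pi * \<i> * of_int m) = cis (pi * of_int m)"
    by (simp add: cis_conv_exp mult_ac)
  also have "\<dots> = (if even m then 1 else - 1)"
    by (simp add: complex_eq_iff cos_npi_int sin_npi_int)
  finally show ?thesis .
qed

text \<open>Reindexing the double series by \<open>m = j + k + 1\<close>, \<open>n = j - k\<close> separates \<open>x\<close> from \<open>y\<close>;
  \<open>m\<close> and \<open>n\<close> run over the pairs of opposite parity.\<close>

lemma vartheta_mult:
  assumes "Im \<tau> > 0"
  shows "vartheta \<tau> (x + y) * vartheta \<tau> (x - y) =
           theta_half {m. even m} \<tau> x * theta_half {m. odd m} \<tau> y
         - theta_half {m. odd m} \<tau> x * theta_half {m. even m} \<tau> y"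
proof -
  define t where "t z j = exp (of_real pi * \<i> * \<tau> * (of_int j + 1/2)^2
      + 2 * of_real pi * \<i> * (of_int j + 1/2) * (z + 1/2))" for z :: complex and j :: int
  define T where "T z m = exp (of_real pi * \<i> * \<tau> / 2 * of_int m ^ 2
      + 2 * of_real pi * \<i> * z * of_int m)" for z :: complex and m :: int
  \<comment> \<open>The sign comes from b = 1/2 in both factors: exp (pi i ((j + 1/2) + (k + 1/2)))
    = (-1)^m for m = j + k + 1.\<close>
  define F where "F = (\<lambda>(m::int, n::int). (if even m then 1 else - 1) * (T x m * T y n))"
  define B where "B = {(m::int, n::int). odd (m + n)}"
  have Re: "Re (of_real pi * \<i> * \<tau>) < 0" "Re (of_real pi * \<i> * \<tau> / 2) < 0"
    using assms by auto
  have t_sum: "(\<lambda>j. norm (t z j)) summable_on UNIV" for z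
  proof -
    have "t z j = exp (of_real pi * \<i> * \<tau> / 4 + of_real pi * \<i> * (z + 1/2)) *
       exp (of_real pi * \<i> * \<tau> * of_int j ^ 2
        + (of_real pi * \<i> * \<tau> + 2 * of_real pi * \<i> * (z + 1/2)) * of_int j)" for j
      by (simp add: t_def algebra_simps power2_eq_square flip: exp_add)
    then show ?thesis
      unfolding norm_mult by (simp only: norm_mult) (intro summable_on_cmult_right gauss_exp_abs_summable[OF Re(1)])
  qed
  have T_sum: "(\<lambda>m. norm (T z m)) summable_on M" for z M
    unfolding T_def by (rule gauss_exp_abs_summable[OF Re(2)])
  have th: "theta_half M \<tau> z = infsum (T z) M" for M z
    by (simp only: theta_half_def T_def[abs_def])
  have prod: "(\<lambda>(m, n). T x m * T y n) summable_on M \<times> M'"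
    "(\<Sum>\<^sub>\<infinity>(m, n)\<in>M \<times> M'. T x m * T y n) = theta_half M \<tau> x * theta_half M' \<tau> y" for M M'
    using infsum_product[OF T_sum T_sum] by (auto simp: th)
  have "vartheta \<tau> (x + y) * vartheta \<tau> (x - y) = infsum (t (x + y)) UNIV * infsum (t (x - y)) UNIV"
    by (simp only: vartheta_def theta_char_def t_def[abs_def])
  also have "\<dots> = (\<Sum>\<^sub>\<infinity>(j, k)\<in>UNIV \<times> UNIV. t (x + y) j * t (x - y) k)"
    by (rule infsum_product[OF t_sum t_sum])
  also have "\<dots> = infsum F B"
  proof (rule infsum_reindex_bij_witness
      [where j = "\<lambda>(j, k). (j + k + 1, j - k)" and i = "\<lambda>(m, n). ((m + n - 1) div 2, (m - n - 1) div 2)"])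
    fix a :: "int \<times> int"
    obtain j k where a: "a = (j, k)" by force
    have "t (x + y) j * t (x - y) k =
        exp (of_real pi * \<i> * of_int (j + k + 1)) * (T x (j + k + 1) * T y (j - k))"
      unfolding t_def T_def exp_add[symmetric]
      by (rule arg_cong[where f = exp]) (simp add: field_simps power2_eq_square)
    then show "F (case a of (j, k) \<Rightarrow> (j + k + 1, j - k)) = (case a of (j, k) \<Rightarrow> t (x + y) j * t (x - y) k)"
      by (simp only: a F_def exp_pi_i_of_int prod.case)
  qed (auto simp: B_def elim!: oddE evenE, presburger+)
  also have "B = ({m. even m} \<times> {n. odd n}) \<union> ({m. odd m} \<times> {n. even n})"
    by (auto simp: B_def)
  also have "infsum F \<dots> = infsum F ({m. even m} \<times> {n. odd n}) + infsum F ({m. odd m} \<times> {n. even n})"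
  proof (rule infsum_Un_disjoint)
    show "F summable_on {m. even m} \<times> {n. odd n}"
      using prod(1) by (rule summable_on_cong[THEN iffD1, rotated]) (auto simp: F_def)
    have "(\<lambda>p. - (case p of (m, n) \<Rightarrow> T x m * T y n)) summable_on {m. odd m} \<times> {n. even n}"
      unfolding summable_on_uminus by (rule prod(1))
    then show "F summable_on {m. odd m} \<times> {n. even n}"
      by (rule summable_on_cong[THEN iffD1, rotated]) (auto simp: F_def)
  qed auto
  also have "infsum F ({m. even m} \<times> {n. odd n}) = theta_half {m. even m} \<tau> x * theta_half {m. odd m} \<tau> y"
    unfolding prod(2)[symmetric] by (rule infsum_cong) (auto simp: F_def)
  also have "infsum F ({m. odd m} \<times> {n. even n}) = - (theta_half {m. odd m} \<tau> x * theta_half {m. even m} \<tau> y)"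
    unfolding prod(2)[symmetric] infsum_uminus[symmetric] by (rule infsum_cong) (auto simp: F_def)
  finally show ?thesis by simp
qed

text \<open>The right side of \<open>vartheta_mult\<close> changes sign when \<open>x\<close> and
  \<open>y\<close> are exchanged. At (s - z) / 2 and (s + z) / 2 this is oddness times
  \<open>vartheta \<tau> s\<close>, which cancels for a suitable \<open>s\<close>.\<close>

lemma vartheta_minus:
  assumes "Im \<tau> > 0"
  shows "vartheta \<tau> (- z) = - vartheta \<tau> z"
proof (cases "\<exists>s. vartheta \<tau> s \<noteq> 0")
  case True
  then obtain s where s: "vartheta \<tau> s \<noteq> 0" by blast
  have half: "a / 2 + b / 2 = (a + b) / 2" "a / 2 - b / 2 = (a - b) / 2" for a b :: complex
    by (simp_all add: add_divide_distrib diff_divide_distrib)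
  have "vartheta \<tau> s * vartheta \<tau> (- z) = - (vartheta \<tau> s * vartheta \<tau> z)"
    using vartheta_mult[OF assms, of "(s - z) / 2" "(s + z) / 2"]
      vartheta_mult[OF assms, of "(s + z) / 2" "(s - z) / 2"]
    by (simp add: half flip: add_divide_distrib diff_divide_distrib)
  with s show ?thesis by (metis mult_left_cancel mult_minus_right)
qed auto

text \<open>By the product formula this is the Pluecker relation for $2 \times 2$ minors.\<close>

lemma vartheta_three_term:
  assumes "Im \<tau> > 0"
  shows "vartheta \<tau> (x + y) * vartheta \<tau> (x - y) * (vartheta \<tau> (z + w) * vartheta \<tau> (z - w))
       - vartheta \<tau> (x + z) * vartheta \<tau> (x - z) * (vartheta \<tau> (y + w) * vartheta \<tau> (y - w))
       + vartheta \<tau> (x + w) * vartheta \<tau> (x - w) * (vartheta \<tau> (y + z) * vartheta \<tau> (y - z)) = 0"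
  unfolding vartheta_mult[OF assms] by (simp add: algebra_simps)

text \<open>The three-term relation at four half sums, chosen so that their twelve pairwise sums and
  differences are the required arguments, two of them up to a sign that oddness removes.\<close>

lemma vartheta_fay:
  assumes "Im \<tau> > 0"
  shows "vartheta \<tau> (x + u) * vartheta \<tau> (y + v) * vartheta \<tau> (x - y) * vartheta \<tau> (u + v)
       = vartheta \<tau> (x - y + u) * vartheta \<tau> (y + u + v) * vartheta \<tau> x * vartheta \<tau> v
       - vartheta \<tau> (y - x + v) * vartheta \<tau> (x + u + v) * vartheta \<tau> y * vartheta \<tau> u"
proof -
  have *: "vartheta \<tau> (y - x + v) = - vartheta \<tau> (x - y - v)" "vartheta \<tau> v = - vartheta \<tau> (- v)"
    using vartheta_minus[OF assms, of "x - y - v"] vartheta_minus[OF assms, of v]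
    by (simp_all add: algebra_simps)
  define p q r s where "p = (x + u + y + v) / 2" and "q = (x + u - y - v) / 2"
    and "r = (x - y + u + v) / 2" and "s = (x - y - u - v) / 2"
  have args: "p + q = x + u" "p - q = y + v" "r + s = x - y" "r - s = u + v"
    "p + r = x + u + v" "p - r = y" "q + s = x - y - v" "q - s = u"
    "p + s = x" "p - s = y + u + v" "q + r = x - y + u" "q - r = - v"
    by (simp_all add: p_def q_def r_def s_def field_simps)
  show ?thesis
    using vartheta_three_term[OF assms, of p q r s]
    unfolding args * by (simp add: algebra_simps)
qed

section \<open>Insertion of an index into a path\<close>

lemma sum_eq_single:
  assumes "finite S" "\<And>x. x \<in> S \<Longrightarrow> x \<noteq> x0 \<Longrightarrow> g x = 0"
  shows "sum g S = (if x0 \<in> S then g x0 else 0)"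
  using assms by (simp add: sum.mono_neutral_right[of S "S \<inter> {x0}" g])

section \<open>Matrix algebra and entrywise derivatives\<close>

lemma matrix_add_rdistrib:
  fixes A B :: "'a::semiring_1^'n^'m" and C :: "'a^'k^'n"
  shows "(A + B) ** C = A ** C + B ** C"
  by (simp add: matrix_matrix_mult_def vec_eq_iff distrib_right sum.distrib)

lemma matrix_diff_ldistrib:
  fixes A :: "'a::ring_1^'n^'m" and B C :: "'a^'k^'n"
  shows "A ** (B - C) = A ** B - A ** C"
  by (simp add: matrix_matrix_mult_def vec_eq_iff right_diff_distrib sum_subtractf)

lemma matrix_diff_rdistrib:
  fixes A B :: "'a::ring_1^'n^'m" and C :: "'a^'k^'n"
  shows "(A - B) ** C = A ** C - B ** C"
  by (simp add: matrix_matrix_mult_def vec_eq_iff left_diff_distrib sum_subtractf)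

lemma matrix_mult_zero_left: "0 ** A = 0" for A :: "'a::semiring_1^'n^'n"
  by (simp add: matrix_matrix_mult_def vec_eq_iff)

lemma matrix_sum_ldistrib:
  fixes A :: "'a::semiring_1^'n^'n" and B :: "'i \<Rightarrow> 'a^'n^'n"
  shows "A ** (\<Sum>i\<in>I. B i) = (\<Sum>i\<in>I. A ** B i)"
  by (induction I rule: infinite_finite_induct)
     (simp_all add: matrix_add_ldistrib)

lemma matrix_sum_rdistrib:
  fixes A :: "'i \<Rightarrow> 'a::semiring_1^'n^'n" and C :: "'a^'n^'n"
  shows "(\<Sum>i\<in>I. A i) ** C = (\<Sum>i\<in>I. A i ** C)"
  by (induction I rule: infinite_finite_induct)
     (simp_all add: matrix_add_rdistrib matrix_mult_zero_left)

definition has_matrix_derivative ::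
    "(complex \<Rightarrow> complex^'m^'n) \<Rightarrow> complex^'m^'n \<Rightarrow> complex \<Rightarrow> bool" where
  "has_matrix_derivative F F' t \<longleftrightarrow>
     (\<forall>p q. ((\<lambda>t. F t $ p $ q) has_field_derivative F' $ p $ q) (at t))"

lemma has_matrix_derivative_mult:
  assumes "has_matrix_derivative F F' t" "has_matrix_derivative G G' t"
  shows "has_matrix_derivative (\<lambda>t. F t ** G t) (F' ** G t + F t ** G') t"
  using assms unfolding has_matrix_derivative_def matrix_matrix_mult_def
  by (auto intro!: derivative_eq_intros simp: sum.distrib algebra_simps)

lemma has_matrix_derivative_sum:
  assumes "\<And>i. i \<in> I \<Longrightarrow> has_matrix_derivative (F i) (F' i) t"
  shows "has_matrix_derivative (\<lambda>t. \<Sum>i\<in>I. F i t) (\<Sum>i\<in>I. F' i) t"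
  using assms unfolding has_matrix_derivative_def
  by (auto intro!: derivative_intros)

text \<open>The Leibniz expansion of a path product, with \<open>R'\<close> as formal derivative of
  the edges; keeping \<open>R'\<close> arbitrary makes the insertion identities purely
  algebraic.\<close>

fun path_deriv :: "('n \<Rightarrow> 'n \<Rightarrow> complex^'m^'m) \<Rightarrow> ('n \<Rightarrow> 'n \<Rightarrow> complex^'m^'m) \<Rightarrow> 'n list \<Rightarrow> complex^'m^'m" where
  "path_deriv R R' (i # j # is) = R' i j ** path_prod R (j # is) + R i j ** path_deriv R R' (j # is)"
| "path_deriv R R' _ = 0"

lemma has_matrix_derivative_path_prod:
  assumes "\<And>x y. x \<noteq> y \<Longrightarrow> has_matrix_derivative (\<lambda>t. R t x y) (R' x y) t0"
    and "successively (\<noteq>) xs"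
  shows "has_matrix_derivative (\<lambda>t. path_prod (R t) xs) (path_deriv (R t0) R' xs) t0"
  using assms(2)
proof (induction xs rule: induct_list012)
  case (3 x y zs)
  then show ?case
    using assms(1) by (auto intro!: has_matrix_derivative_mult)
qed (simp_all add: has_matrix_derivative_def)

text \<open>The index \<open>c\<close> is inserted into one edge, and the results are summed over
  all edges of the path.\<close>

fun insertion_sum :: "('n \<Rightarrow> 'n \<Rightarrow> complex^'m^'m) \<Rightarrow> 'n \<Rightarrow> 'n list \<Rightarrow> complex^'m^'m" where
  "insertion_sum R c (i # j # is) =
     R i c ** R c j ** path_prod R (j # is) + R i j ** insertion_sum R c (j # is)"
| "insertion_sum R c _ = 0"

text \<open>The path has \<open>length is + 1\<close> edges; summand \<open>k\<close> inserts
  \<open>c\<close> into edge \<open>k\<close>, counted from 0.\<close>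

lemma insertion_sum_eq:
  "(\<Sum>k\<le>length is. path_prod R (x # take k is @ c # drop k is @ [e])) = insertion_sum R c (x # is @ [e])"
proof (induction "is" arbitrary: x)
  case Nil
  show ?case by (simp add: matrix_mul_assoc)
next
  case (Cons i "is")
  have "(\<Sum>k\<le>length (i # is). path_prod R (x # take k (i # is) @ c # drop k (i # is) @ [e]))
      = path_prod R (x # c # i # is @ [e])
      + (\<Sum>k\<le>length is. path_prod R (x # i # take k is @ c # drop k is @ [e]))"
    unfolding length_Cons sum.atMost_Suc_shift by (simp del: path_prod.simps)
  also have "(\<Sum>k\<le>length is. path_prod R (x # i # take k is @ c # drop k is @ [e]))
      = R x i ** insertion_sum R c (i # is @ [e])"
    by (simp add: matrix_sum_ldistrib flip: Cons.IH)
  finally show ?case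
    by (simp add: matrix_mul_assoc)
qed

text \<open>The recursions peel off edges on the left, whereas a closed path arises from an open one
  by adding an edge on the right. Hence this lemma and the next two.\<close>

lemma path_prod_snoc: "path_prod R (xs @ [m, e]) = path_prod R (xs @ [m]) ** R m e"
proof (induction xs rule: induct_list012)
  case (3 x y zs)
  then show ?case by (simp add: matrix_mul_assoc)
qed (simp_all add: matrix_mul_assoc)

lemma path_deriv_snoc:
  "path_deriv R R' (xs @ [m, e]) = path_deriv R R' (xs @ [m]) ** R m e + path_prod R (xs @ [m]) ** R' m e"
proof (induction xs rule: induct_list012)
  case (3 x y zs)
  then show ?case
    using path_prod_snoc[of R "y # zs" m e]
    by (simp add: matrix_mul_assoc matrix_add_ldistrib matrix_add_rdistrib)
qed (simp_all add: matrix_mul_assoc matrix_add_ldistrib matrix_add_rdistrib)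

lemma insertion_sum_snoc:
  "insertion_sum R c (xs @ [m, e]) =
     insertion_sum R c (xs @ [m]) ** R m e + path_prod R (xs @ [m]) ** (R m c ** R c e)"
proof (induction xs rule: induct_list012)
  case (3 x y zs)
  then show ?case
    using path_prod_snoc[of R "y # zs" m e]
    by (simp add: matrix_mul_assoc matrix_add_ldistrib matrix_add_rdistrib)
qed (simp_all add: matrix_mul_assoc matrix_add_ldistrib matrix_add_rdistrib)

section \<open>Insertion under an abstract edge relation, with \<open>s v\<close> in the role of
  r_cv\<close>

context
  fixes R R' :: "'n \<Rightarrow> 'n \<Rightarrow> complex^'m^'m" and s :: "'n \<Rightarrow> complex^'m^'m" and c :: 'n
  assumes edge: "\<And>x y. \<lbrakk>x \<noteq> y; x \<noteq> c; y \<noteq> c\<rbrakk> \<Longrightarrow> R x c ** R c y = s y ** R x y - R x y ** s x - R' x y"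
    and commute: "\<And>x y v. \<lbrakk>x \<noteq> c; y \<noteq> c; v \<noteq> x; v \<noteq> y\<rbrakk> \<Longrightarrow> R x y ** s v = s v ** R x y"
begin

lemma path_prod_commute:
  assumes "distinct xs" "v \<notin> set xs" "c \<notin> set xs"
  shows "path_prod R xs ** s v = s v ** path_prod R xs"
  using assms
proof (induction xs rule: induct_list012)
  case (3 x y zs)
  have "path_prod R (x # y # zs) ** s v = R x y ** (path_prod R (y # zs) ** s v)"
    by (simp add: matrix_mul_assoc)
  also have "\<dots> = (R x y ** s v) ** path_prod R (y # zs)"
    using 3 by (simp add: matrix_mul_assoc)
  also have "R x y ** s v = s v ** R x y"
    using 3 by (intro commute) auto
  finally show ?case
    by (simp add: matrix_mul_assoc)
qed simp_all

text \<open>The first edge puts \<open>s y\<close> on the left and \<open>s x\<close> between that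
  edge and the rest of the path. As \<open>x\<close> does not recur, \<open>s x\<close> moves to the
  right end, while the left sum of the induction hypothesis passes the first edge. So the left sum
  misses the start and the right sum misses the end of the path.\<close>

lemma insertion_sum_open:
  assumes "distinct (x # xs)" "c \<notin> set (x # xs)"
  shows "insertion_sum R c (x # xs) =
      (\<Sum>v\<in>set xs. s v) ** path_prod R (x # xs)
    - path_prod R (x # xs) ** (\<Sum>v\<in>set (butlast (x # xs)). s v)
    - path_deriv R R' (x # xs)"
  using assms
proof (induction xs arbitrary: x)
  case (Cons y zs)
  define P where "P = path_prod R (y # zs)"
  have IH: "insertion_sum R c (y # zs) =
      (\<Sum>v\<in>set zs. s v) ** P - P ** (\<Sum>v\<in>set (butlast (y # zs)). s v) - path_deriv R R' (y # zs)"
    using Cons unfolding P_def by (intro Cons.IH) auto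
  have 1: "R x y ** (\<Sum>v\<in>set zs. s v) = (\<Sum>v\<in>set zs. s v) ** R x y"
    unfolding matrix_sum_ldistrib matrix_sum_rdistrib
    using Cons.prems by (intro sum.cong refl commute) auto
  have 2: "P ** s x = s x ** P"
    unfolding P_def using Cons.prems by (intro path_prod_commute) auto
  have 3: "R x c ** R c y = s y ** R x y - R x y ** s x - R' x y"
    using Cons.prems by (intro edge) auto
  have "x \<notin> set (butlast (y # zs))"
    using Cons.prems by (auto dest: in_set_butlastD)
  then have 4: "(\<Sum>v\<in>set (butlast (x # y # zs)). s v) = s x + (\<Sum>v\<in>set (butlast (y # zs)). s v)"
    by simp
  have 5: "(\<Sum>v\<in>set (y # zs). s v) = s y + (\<Sum>v\<in>set zs. s v)"
    using Cons.prems by simp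
  have "insertion_sum R c (x # y # zs) = R x c ** R c y ** P + R x y ** insertion_sum R c (y # zs)"
    by (simp add: P_def)
  also have "\<dots> = (s y ** R x y - R x y ** s x - R' x y) ** P
      + R x y ** ((\<Sum>v\<in>set zs. s v) ** P - P ** (\<Sum>v\<in>set (butlast (y # zs)). s v) - path_deriv R R' (y # zs))"
    unfolding 3 IH ..
  also have "\<dots> = s y ** R x y ** P - R x y ** (s x ** P) - R' x y ** P
      + (R x y ** (\<Sum>v\<in>set zs. s v)) ** P - R x y ** P ** (\<Sum>v\<in>set (butlast (y # zs)). s v)
      - R x y ** path_deriv R R' (y # zs)"
    by (simp add: matrix_diff_ldistrib matrix_diff_rdistrib matrix_mul_assoc)
  also have "\<dots> = (s y + (\<Sum>v\<in>set zs. s v)) ** (R x y ** P)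
      - (R x y ** P) ** (s x + (\<Sum>v\<in>set (butlast (y # zs)). s v))
      - (R' x y ** P + R x y ** path_deriv R R' (y # zs))"
    unfolding 1 2[symmetric] by (simp add: matrix_add_ldistrib matrix_add_rdistrib matrix_mul_assoc)
  finally show ?case
    unfolding 4 5 by (simp add: P_def)
qed simp

text \<open>Add the closing edge from the last element \<open>m\<close> back to \<open>a\<close>:
  its term with \<open>s a\<close> cancels the one that the open path leaves on the right. The
  remaining sum \<open>T\<close> commutes with \<open>R m a\<close>, so both sides end with the same
  sum over \<open>xs\<close>.\<close>

lemma insertion_sum_closed:
  assumes "distinct (a # xs)" "c \<notin> set (a # xs)" "xs \<noteq> []"
  shows "insertion_sum R c (a # xs @ [a]) =
      (\<Sum>v\<in>set xs. s v) ** path_prod R (a # xs @ [a])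
    - path_prod R (a # xs @ [a]) ** (\<Sum>v\<in>set xs. s v)
    - path_deriv R R' (a # xs @ [a])"
proof -
  obtain ys m where xs: "xs = ys @ [m]"
    using assms(3) by (cases xs rule: rev_cases) auto
  define Q where "Q = path_prod R (a # ys @ [m])"
  define T where "T = (\<Sum>v\<in>set ys. s v)"
  define T' where "T' = (\<Sum>v\<in>set xs. s v)"
  have T': "T' = T + s m"
    using assms(1) by (simp add: T'_def T_def xs add.commute)
  have "insertion_sum R c (a # xs) = T' ** path_prod R (a # xs)
      - path_prod R (a # xs) ** (\<Sum>v\<in>set (butlast (a # xs)). s v) - path_deriv R R' (a # xs)"
    unfolding T'_def by (rule insertion_sum_open) (use assms in auto)
  also have "(\<Sum>v\<in>set (butlast (a # xs)). s v) = s a + T"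
    using assms(1) by (simp add: xs T_def)
  finally have open_path: "insertion_sum R c (a # ys @ [m])
      = T' ** Q - Q ** (s a + T) - path_deriv R R' (a # ys @ [m])"
    by (simp add: xs Q_def)
  have edge': "R m c ** R c a = s a ** R m a - R m a ** s m - R' m a"
    using assms by (intro edge) (auto simp: xs)
  have comm: "R m a ** T = T ** R m a"
    unfolding T_def matrix_sum_ldistrib matrix_sum_rdistrib
    using assms by (intro sum.cong refl commute) (auto simp: xs)
  have "insertion_sum R c (a # xs @ [a]) =
      (T' ** Q - Q ** (s a + T) - path_deriv R R' (a # ys @ [m])) ** R m a
      + Q ** (s a ** R m a - R m a ** s m - R' m a)"
    using insertion_sum_snoc[of R c "a # ys" m a] by (simp add: xs open_path edge' Q_def)
  also have "\<dots> = T' ** (Q ** R m a) - Q ** (T ** R m a) - Q ** R m a ** s m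
      - (path_deriv R R' (a # ys @ [m]) ** R m a + Q ** R' m a)"
    by (simp add: matrix_diff_ldistrib matrix_diff_rdistrib matrix_add_ldistrib matrix_add_rdistrib
        matrix_mul_assoc)
  also have "\<dots> = T' ** (Q ** R m a) - (Q ** R m a) ** T'
      - (path_deriv R R' (a # ys @ [m]) ** R m a + Q ** R' m a)"
    unfolding comm[symmetric] T' by (simp add: matrix_add_ldistrib matrix_mul_assoc)
  finally show ?thesis
    using path_prod_snoc[of R "a # ys" m a] path_deriv_snoc[of R R' "a # ys" m a]
    by (simp add: xs Q_def T'_def)
qed

end

section \<open>Orderings of a finite set\<close>

lemma finite_orderings: "finite {xs. distinct xs \<and> set xs = S}" if "finite S"
  by (rule finite_subset[OF _ finite_subset_distinct[OF that]]) auto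

text \<open>An ordering of \<open>insert c S\<close> corresponds to an ordering of \<open>S\<close>
  together with the position of \<open>c\<close>, which is the length of the prefix before
  \<open>c\<close>.\<close>

lemma sum_orderings_insert:
  assumes "finite S" "c \<notin> S"
  shows "(\<Sum>xs | distinct xs \<and> set xs = insert c S. F xs) =
    (\<Sum>xs | distinct xs \<and> set xs = S. \<Sum>k\<le>length xs. F (take k xs @ c # drop k xs))"
proof -
  have *: "xs = take (length (takeWhile (\<lambda>x. x \<noteq> c) xs)) (remove1 c xs) @ c
        # drop (length (takeWhile (\<lambda>x. x \<noteq> c) xs)) (remove1 c xs)
      \<and> set (remove1 c xs) = S \<and> length (takeWhile (\<lambda>x. x \<noteq> c) xs) \<le> length (remove1 c xs)"
    if xs_prems: "distinct xs" "set xs = insert c S" for xs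
  proof -
    obtain ys zs where xs: "xs = ys @ c # zs" "c \<notin> set ys"
      using xs_prems(2) split_list_first[of c xs] by auto
    have "takeWhile (\<lambda>x. x \<noteq> c) xs = ys"
      using xs by (auto simp: takeWhile_append)
    moreover have "remove1 c xs = ys @ zs"
      using xs by (simp add: remove1_append)
    moreover have "set (ys @ zs) = S"
      using xs_prems assms(2) xs by auto
    ultimately show ?thesis
      using xs by simp
  qed
  have "(\<Sum>xs | distinct xs \<and> set xs = S. \<Sum>k\<le>length xs. F (take k xs @ c # drop k xs)) =
      (\<Sum>(xs, k)\<in>(SIGMA xs:{xs. distinct xs \<and> set xs = S}. {..length xs}). F (take k xs @ c # drop k xs))"
    using finite_orderings[OF assms(1)] by (subst sum.Sigma) auto
  also have "\<dots> = (\<Sum>xs | distinct xs \<and> set xs = insert c S. F xs)"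
  proof (rule sum.reindex_bij_witness
      [where i = "\<lambda>xs. (remove1 c xs, length (takeWhile (\<lambda>x. x \<noteq> c) xs))"
         and j = "\<lambda>(xs, k). take k xs @ c # drop k xs"])
    fix p assume "p \<in> (SIGMA xs:{xs. distinct xs \<and> set xs = S}. {..length xs})"
    then obtain xs k where p: "p = (xs, k)" "distinct xs" "set xs = S" "k \<le> length xs"
      by auto
    have c: "c \<notin> set (take k xs)"
      using assms(2) p by (auto dest: in_set_takeD)
    then have "takeWhile (\<lambda>x. x \<noteq> c) (take k xs @ c # drop k xs) = take k xs"
      by (subst takeWhile_append2) auto
    with c p show "(remove1 c (case p of (xs, k) \<Rightarrow> take k xs @ c # drop k xs),
         length (takeWhile (\<lambda>x. x \<noteq> c) (case p of (xs, k) \<Rightarrow> take k xs @ c # drop k xs))) = p"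
      by (simp add: remove1_append)
    have "set (take k xs @ c # drop k xs) = insert c S"
      using p by (metis append_take_drop_id list.simps(15) set_append Un_insert_right)
    moreover have "distinct (take k xs @ c # drop k xs)"
      using p assms(2) distinct_append[of "take k xs" "drop k xs"]
      by (auto dest: in_set_takeD in_set_dropD)
    ultimately show "(case p of (xs, k) \<Rightarrow> take k xs @ c # drop k xs) \<in> {xs. distinct xs \<and> set xs = insert c S}"
      by (simp add: p)
  next
    fix xs assume "xs \<in> {xs. distinct xs \<and> set xs = insert c S}"
    with *[of xs] show "(case (remove1 c xs, length (takeWhile (\<lambda>x. x \<noteq> c) xs)) of
        (xs, k) \<Rightarrow> take k xs @ c # drop k xs) = xs"
      and "(remove1 c xs, length (takeWhile (\<lambda>x. x \<noteq> c) xs))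
        \<in> (SIGMA xs:{xs. distinct xs \<and> set xs = S}. {..length xs})"
      by simp_all
  qed auto
  finally show ?thesis ..
qed

section \<open>Operators on two tensor factors\<close>

text \<open>All column indices of a row \<open>(i, j)\<close> of the $R$-matrix lie in \<open>{i, j}\<close>, so its action on functions of
  two indices needs no sum.  The last coefficient has the opposite argument because
  $E_{jj} \otimes E_{ij}$ lives in row \<open>(j, i)\<close>.\<close>

definition pair_act ::
    "(complex \<Rightarrow> complex) \<Rightarrow> (complex \<Rightarrow> complex) \<Rightarrow> (complex \<Rightarrow> complex) \<Rightarrow> (complex \<Rightarrow> complex) \<Rightarrow> complex
      \<Rightarrow> ('k \<Rightarrow> complex) \<Rightarrow> ('k \<Rightarrow> 'k \<Rightarrow> complex) \<Rightarrow> 'k \<Rightarrow> 'k \<Rightarrow> complex" where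
  "pair_act A B C D d u g i j =
     (if i = j then d * g i j
      else A (u j - u i) * g i j + B (u j - u i) * g j i - C (u j - u i) * g j j + D (u i - u j) * g i i)"

text \<open>\<open>T\<close> acts on the delta function of column \<open>q\<close> in the indices at
  positions \<open>a\<close> and \<open>b\<close>, while the other entries of \<open>p\<close> stay
  frozen.\<close>

definition pair_matrix :: "'n \<Rightarrow> 'n \<Rightarrow> (('k \<Rightarrow> 'k \<Rightarrow> complex) \<Rightarrow> 'k \<Rightarrow> 'k \<Rightarrow> complex)
    \<Rightarrow> complex^('n::finite \<Rightarrow> 'k::finite)^('n \<Rightarrow> 'k)" where
  "pair_matrix a b T = (\<chi> p q. T (\<lambda>i j. of_bool (p(a := i, b := j) = q)) (p a) (p b))"

lemma sum_of_bool_eq_mult: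
  fixes f :: "'a::finite \<Rightarrow> complex"
  shows "(\<Sum>r\<in>UNIV. of_bool (x = r) * f r) = f x"
  by (simp add: of_bool_def if_distrib[of "\<lambda>t. t * _"] cong: if_cong)

text \<open>Each delta collapses the sum of the matrix product, so products become nested operators
  with the left factor outermost.\<close>

lemma pair_matrix_mult:
  "(pair_matrix a b (pair_act A B C D d u) ** M) $ p $ q
     = pair_act A B C D d u (\<lambda>i j. M $ (p(a := i, b := j)) $ q) (p a) (p b)"
  by (simp add: matrix_matrix_mult_def pair_matrix_def pair_act_def distrib_right left_diff_distrib
      sum.distrib sum_subtractf mult.assoc sum_of_bool_eq_mult flip: sum_distrib_left)

lemma pair_act_commute:
  "pair_act A B C D d u (\<lambda>i j. pair_act A' B' C' D' d' u (\<lambda>k l. f i j k l) k l) i j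
     = pair_act A' B' C' D' d' u (\<lambda>k l. pair_act A B C D d u (\<lambda>i j. f i j k l) i j) k l"
  by (simp add: pair_act_def algebra_simps)

lemma pair_act_has_field_derivative:
  assumes "\<And>v. ((\<lambda>t. A t v) has_field_derivative A' v) (at t0)"
    and "\<And>v. ((\<lambda>t. B t v) has_field_derivative B' v) (at t0)"
    and "\<And>v. ((\<lambda>t. C t v) has_field_derivative C' v) (at t0)"
    and "\<And>v. ((\<lambda>t. D t v) has_field_derivative D' v) (at t0)"
    and "(d has_field_derivative d') (at t0)"
  shows "((\<lambda>t. pair_act (A t) (B t) (C t) (D t) (d t) u f i j)
           has_field_derivative pair_act A' B' C' D' d' u f i j) (at t0)"
proof (cases "i = j")
  case True
  then show ?thesis
    using DERIV_cmult_right[OF assms(5)] by (simp add: pair_act_def)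
next
  case False
  have "((\<lambda>t. A t (u j - u i) * f i j + B t (u j - u i) * f j i - C t (u j - u i) * f j j + D t (u i - u j) * f i i)
      has_field_derivative A' (u j - u i) * f i j + B' (u j - u i) * f j i - C' (u j - u i) * f j j + D' (u i - u j) * f i i) (at t0)"
    by (intro DERIV_add DERIV_diff DERIV_cmult_right assms)
  with False show ?thesis
    by (simp add: pair_act_def)
qed

lemma pair_matrix_commute:
  assumes "a \<noteq> c" "a \<noteq> d" "b \<noteq> c" "b \<noteq> d"
  shows "pair_matrix a b (pair_act A B C D e u) ** pair_matrix c d (pair_act A' B' C' D' e' u)
       = pair_matrix c d (pair_act A' B' C' D' e' u) ** pair_matrix a b (pair_act A B C D e u)"
proof -
  have *: "p(a := i, b := j, c := k, d := l) = p(c := k, d := l, a := i, b := j)"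
    for p :: "'a \<Rightarrow> 'b" and i j k l
    using assms by auto
  have "pair_act A B C D e u (\<lambda>i j. pair_act A' B' C' D' e' u
         (\<lambda>k l. of_bool (p(a := i, b := j, c := k, d := l) = q)) (p c) (p d)) (p a) (p b)
      = pair_act A' B' C' D' e' u (\<lambda>k l. pair_act A B C D e u
         (\<lambda>i j. of_bool (p(c := k, d := l, a := i, b := j) = q)) (p a) (p b)) (p c) (p d)" for p q
    unfolding * by (rule pair_act_commute)
  then show ?thesis
    using assms by (simp add: vec_eq_iff pair_matrix_mult) (simp add: pair_matrix_def)
qed

lemma successively_cycle:
  assumes "distinct (a # xs)" "xs \<noteq> []"
  shows "successively (\<noteq>) (a # xs @ [a])"
proof -
  have "successively (\<noteq>) ys" if "distinct ys" for ys :: "'a list"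
    using that by (induction ys rule: induct_list012) auto
  from this[OF assms(1)] show ?thesis
    using successively_append_iff[of "(\<noteq>)" "a # xs" "[a]"] last_in_set[of xs] assms by auto
qed

section \<open>Identities of the Kronecker function\<close>

context
  fixes \<tau> :: complex
  assumes Im_pos: "Im \<tau> > 0"
begin

abbreviation \<theta> :: "complex \<Rightarrow> complex" where "\<theta> \<equiv> vartheta \<tau>"
abbreviation \<theta>' :: "complex \<Rightarrow> complex" where "\<theta>' \<equiv> deriv (vartheta \<tau>)"
abbreviation \<phi> :: "complex \<Rightarrow> complex \<Rightarrow> complex" where "\<phi> \<equiv> kronecker_phi \<tau>"
abbreviation \<phi>' :: "complex \<Rightarrow> complex \<Rightarrow> complex" where "\<phi>' x y \<equiv> deriv (\<lambda>x. kronecker_phi \<tau> x y) x"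
abbreviation E :: "complex \<Rightarrow> complex" where "E \<equiv> eisenstein_E1 \<tau>"
abbreviation E' :: "complex \<Rightarrow> complex" where "E' \<equiv> deriv (eisenstein_E1 \<tau>)"

lemma theta_minus [simp]: "\<theta> (- z) = - \<theta> z"
  by (rule vartheta_minus[OF Im_pos])

lemma theta_diff_eq_0_commute: "\<theta> (x - y) = 0 \<longleftrightarrow> \<theta> (y - x) = 0"
  using theta_minus[of "x - y"] by simp

lemma theta_0 [simp]: "\<theta> 0 = 0"
  using theta_minus[of 0] by simp

lemma theta_has_field_derivative: "(\<theta> has_field_derivative \<theta>' z) (at z within A)"
  using vartheta_holomorphic[OF Im_pos, of UNIV]
  by (intro has_field_derivative_at_within[OF holomorphic_derivI[of _ UNIV]]) auto

lemma theta'_has_field_derivative: "(\<theta>' has_field_derivative deriv \<theta>' z) (at z within A)"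
  using vartheta_holomorphic[OF Im_pos, of UNIV]
  by (intro has_field_derivative_at_within[OF holomorphic_derivI[of _ UNIV]] holomorphic_deriv) auto

lemmas theta_derivative_intros [derivative_intros] =
  DERIV_chain2[OF theta_has_field_derivative] DERIV_chain2[OF theta'_has_field_derivative]

lemma theta'_minus [simp]: "\<theta>' (- z) = \<theta>' z"
proof -
  have 1: "((\<lambda>z. \<theta> (- z)) has_field_derivative - \<theta>' (- z)) (at z)"
    by (rule derivative_eq_intros refl)+ simp
  have 2: "((\<lambda>z. \<theta> (- z)) has_field_derivative - \<theta>' z) (at z)"
    unfolding theta_minus by (auto intro!: derivative_eq_intros)
  show ?thesis
    using DERIV_unique[OF 1 2] by simp
qed

lemma theta''_minus [simp]: "deriv \<theta>' (- z) = - deriv \<theta>' z"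
proof -
  have 1: "((\<lambda>z. \<theta>' (- z)) has_field_derivative - deriv \<theta>' (- z)) (at z)"
    by (rule derivative_eq_intros refl)+ simp
  have 2: "((\<lambda>z. \<theta>' (- z)) has_field_derivative deriv \<theta>' z) (at z)"
    unfolding theta'_minus by (auto intro!: derivative_eq_intros)
  show ?thesis
    using DERIV_unique[OF 1 2] by (simp only: minus_equation_iff[of _ "deriv \<theta>' z"])
qed

text \<open>The derivative of the Fay identity in \<open>y\<close> at \<open>y = x\<close>; the next lemma differentiates once more,
  in \<open>b\<close> at \<open>b = - a\<close>.\<close>

lemma theta_fay_deriv:
  "\<theta>' 0 * \<theta> (x + a) * \<theta> (x + b) * \<theta> (a + b)
     = \<theta> x * \<theta> (x + a + b) * (\<theta>' a * \<theta> b + \<theta> a * \<theta>' b)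
     - (\<theta>' (x + a + b) * \<theta> x - \<theta> (x + a + b) * \<theta>' x) * \<theta> a * \<theta> b"
proof -
  let ?L = "\<lambda>y. \<theta> (x + a) * \<theta> (y + b) * \<theta> (x - y) * \<theta> (a + b)"
  let ?R = "\<lambda>y. \<theta> (x - y + a) * \<theta> (y + a + b) * \<theta> x * \<theta> b - \<theta> (y - x + b) * \<theta> (x + a + b) * \<theta> y * \<theta> a"
  \<comment> \<open>\<open>\<theta> (x - y)\<close> vanishes at y = x, so only the term with its
    derivative survives.\<close>
  have L: "(?L has_field_derivative - (\<theta>' 0 * \<theta> (x + a) * \<theta> (x + b) * \<theta> (a + b))) (at x)"
    by (auto intro!: derivative_eq_intros)
  have R: "(?R has_field_derivative
      - (\<theta> x * \<theta> (x + a + b) * (\<theta>' a * \<theta> b + \<theta> a * \<theta>' b)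
     - (\<theta>' (x + a + b) * \<theta> x - \<theta> (x + a + b) * \<theta>' x) * \<theta> a * \<theta> b)) (at x)"
    by (rule derivative_eq_intros refl)+ (simp add: algebra_simps)
  have "?L = ?R"
    using vartheta_fay[OF Im_pos, of x a _ b] by (intro ext)
  with L have "(?R has_field_derivative - (\<theta>' 0 * \<theta> (x + a) * \<theta> (x + b) * \<theta> (a + b))) (at x)"
    by simp
  from DERIV_unique[OF this R] show ?thesis
    by (simp only: neg_equal_iff_equal)
qed

lemma theta_fay_deriv2:
  "\<theta>' 0 ^ 2 * \<theta> (x + a) * \<theta> (x - a)
     = (\<theta>' a ^ 2 - \<theta> a * deriv \<theta>' a) * \<theta> x ^ 2 - (\<theta>' x ^ 2 - \<theta> x * deriv \<theta>' x) * \<theta> a ^ 2"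
proof -
  let ?L = "\<lambda>b. \<theta>' 0 * \<theta> (x + a) * \<theta> (x + b) * \<theta> (a + b)"
  let ?R = "\<lambda>b. \<theta> x * \<theta> (x + a + b) * (\<theta>' a * \<theta> b + \<theta> a * \<theta>' b)
     - (\<theta>' (x + a + b) * \<theta> x - \<theta> (x + a + b) * \<theta>' x) * \<theta> a * \<theta> b"
  have L: "(?L has_field_derivative \<theta>' 0 ^ 2 * \<theta> (x + a) * \<theta> (x - a)) (at (- a))"
    by (rule derivative_eq_intros refl)+ (simp add: power2_eq_square)
  have R: "(?R has_field_derivative (\<theta>' a ^ 2 - \<theta> a * deriv \<theta>' a) * \<theta> x ^ 2
       - (\<theta>' x ^ 2 - \<theta> x * deriv \<theta>' x) * \<theta> a ^ 2) (at (- a))"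
    by (rule derivative_eq_intros refl)+ (simp add: power2_eq_square algebra_simps)
  have "?L = ?R"
    using theta_fay_deriv[of x a] by (intro ext)
  with L have "(?R has_field_derivative \<theta>' 0 ^ 2 * \<theta> (x + a) * \<theta> (x - a)) (at (- a))"
    by simp
  from DERIV_unique[OF this R] show ?thesis .
qed

lemma phi_commute: "\<phi> x y = \<phi> y x"
  by (simp add: kronecker_phi_def add.commute mult.commute)

lemma phi_minus: "\<phi> (- x) (- y) = - \<phi> x y"
  using theta_minus[of "x + y"] by (simp add: kronecker_phi_def)

lemma E_minus [simp]: "E (- x) = - E x"
  by (simp add: eisenstein_E1_def)

lemma E_has_field_derivative:
  assumes "\<theta> x \<noteq> 0"
  shows "(E has_field_derivative (deriv \<theta>' x * \<theta> x - \<theta>' x ^ 2) / \<theta> x ^ 2) (at x)"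
  unfolding eisenstein_E1_def[abs_def] using assms
  by (auto intro!: derivative_eq_intros simp: power2_eq_square)

lemma phi_has_field_derivative:
  assumes "\<theta> x \<noteq> 0"
  shows "((\<lambda>x. \<phi> x y) has_field_derivative \<phi>' x y) (at x)"
    and "\<phi>' x y = \<theta>' 0 * (\<theta>' (x + y) * \<theta> x - \<theta> (x + y) * \<theta>' x) / (\<theta> x ^ 2 * \<theta> y)"
proof -
  have *: "((\<lambda>x. \<phi> x y) has_field_derivative
      \<theta>' 0 * (\<theta>' (x + y) * \<theta> x - \<theta> (x + y) * \<theta>' x) / (\<theta> x ^ 2 * \<theta> y)) (at x)"
  proof (cases "\<theta> y = 0")
    \<comment> \<open>Division by zero makes both sides zero. The case is covered because
      \<open>pair_act_has_field_derivative\<close> asks for the derivative at every second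
      argument.\<close>
    case True
    then show ?thesis by (simp add: kronecker_phi_def)
  next
    case False
    with assms show ?thesis
      unfolding kronecker_phi_def[abs_def]
      by (auto intro!: derivative_eq_intros simp: field_simps power2_eq_square)
  qed
  then show "\<phi>' x y = \<theta>' 0 * (\<theta>' (x + y) * \<theta> x - \<theta> (x + y) * \<theta>' x) / (\<theta> x ^ 2 * \<theta> y)"
    by (rule DERIV_imp_deriv)
  with * show "((\<lambda>x. \<phi> x y) has_field_derivative \<phi>' x y) (at x)"
    by simp
qed

text \<open>This is \<open>vartheta_fay\<close> times the square of \<open>\<theta>' 0\<close>,
  divided by the six theta values assumed nonzero.\<close>

lemma phi_fay:
  assumes "\<theta> x \<noteq> 0" "\<theta> y \<noteq> 0" "\<theta> u \<noteq> 0" "\<theta> v \<noteq> 0" "\<theta> (x - y) \<noteq> 0" "\<theta> (u + v) \<noteq> 0"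
  shows "\<phi> x u * \<phi> y v = \<phi> (x - y) u * \<phi> y (u + v) + \<phi> (y - x) v * \<phi> x (u + v)"
proof -
  have yx: "\<theta> (y - x) = - \<theta> (x - y)"
    using theta_minus[of "x - y"] by simp
  show ?thesis
    using arg_cong[OF vartheta_fay[OF Im_pos, of x u y v], of "\<lambda>t. \<theta>' 0 * (\<theta>' 0 * t)"] assms
    unfolding kronecker_phi_def yx
    by (simp add: field_simps; simp add: algebra_simps)
qed

text \<open>The term \<^term>\<open>\<phi>' x (a + b)\<close> is not written as
  \<^term>\<open>\<phi> x (a + b) * (E (x + a + b) - E x)\<close>, which is wrong when \<^term>\<open>\<theta> (x + a + b) = 0\<close>
  since division by zero yields zero.\<close>

lemma phi_mult_same_left:
  assumes "\<theta> x \<noteq> 0" "\<theta> a \<noteq> 0" "\<theta> b \<noteq> 0" "\<theta> (a + b) \<noteq> 0"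
  shows "\<phi> x a * \<phi> x b = \<phi> x (a + b) * (E a + E b) - \<phi>' x (a + b)"
proof -
  have "\<phi> x a * \<phi> x b = \<theta>' 0 * (\<theta>' 0 * \<theta> (x + a) * \<theta> (x + b) * \<theta> (a + b))
          / (\<theta> x ^ 2 * \<theta> a * \<theta> b * \<theta> (a + b))"
    using assms by (simp add: kronecker_phi_def power2_eq_square field_simps)
  also have "\<dots> = \<phi> x (a + b) * (E a + E b) - \<phi>' x (a + b)"
    unfolding theta_fay_deriv phi_has_field_derivative(2)[OF assms(1)]
    unfolding kronecker_phi_def eisenstein_E1_def
    using assms by (simp add: divide_simps add.assoc; simp add: algebra_simps power2_eq_square)
  finally show ?thesis .
qed

text \<open>By symmetry \<open>\<phi>' y x\<close> differentiates \<phi> in its other slot. The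
  terms with \<open>\<theta>' (x + y)\<close> agree in both derivatives, so the formula also holds
  where \<open>\<theta> (x + y)\<close> vanishes.\<close>

lemma phi'_commute:
  assumes "\<theta> x \<noteq> 0" "\<theta> y \<noteq> 0"
  shows "\<phi>' y x = \<phi>' x y + \<phi> x y * (E x - E y)"
  using assms unfolding phi_has_field_derivative(2)[OF assms(1)] phi_has_field_derivative(2)[OF assms(2)]
  unfolding kronecker_phi_def eisenstein_E1_def
  by (simp add: divide_simps add.commute; simp add: algebra_simps power2_eq_square)

text \<open>Symmetry reduces this to \<open>phi_mult_same_left\<close>; \<open>phi'_commute\<close>
  then moves the derivative to the slot of \<open>x + y\<close>.\<close>

lemma phi_mult_same_right:
  assumes "\<theta> x \<noteq> 0" "\<theta> y \<noteq> 0" "\<theta> c \<noteq> 0" "\<theta> (x + y) \<noteq> 0"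
  shows "\<phi> x c * \<phi> y c = \<phi> (x + y) c * (E x + E y - E (x + y) + E c) - \<phi>' (x + y) c"
  using phi_mult_same_left[of c x y] phi'_commute[of "x + y" c] assms
  by (simp add: phi_commute algebra_simps)

text \<open>The derivative term depends only on the sum of the arguments and cancels in the
  difference.\<close>

lemma phi_mult_same_right_diff:
  assumes "\<theta> x \<noteq> 0" "\<theta> y \<noteq> 0" "\<theta> x' \<noteq> 0" "\<theta> y' \<noteq> 0" "\<theta> c \<noteq> 0" "\<theta> (x + y) \<noteq> 0" "x' + y' = x + y"
  shows "\<phi> x c * \<phi> y c - \<phi> x' c * \<phi> y' c = \<phi> (x + y) c * (E x + E y - E x' - E y')"
proof -
  have 1: "\<phi> x c * \<phi> y c = \<phi> (x + y) c * (E x + E y - E (x + y) + E c) - \<phi>' (x + y) c"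
    using assms by (intro phi_mult_same_right) auto
  have 2: "\<phi> x' c * \<phi> y' c = \<phi> (x + y) c * (E x' + E y' - E (x + y) + E c) - \<phi>' (x + y) c"
    using phi_mult_same_right[of x' y' c] assms by simp
  show ?thesis
    unfolding 1 2 by (simp add: algebra_simps)
qed

text \<open>The classical product formula with value \<wp>(x) - \<wp>(c), since \<wp> is -E' plus a
  constant.\<close>

lemma phi_mult_opposite:
  assumes "\<theta> x \<noteq> 0" "\<theta> c \<noteq> 0"
  shows "\<phi> x c * \<phi> x (- c) = E' c - E' x"
proof -
  have "\<phi> x c * \<phi> x (- c) = - (\<theta>' 0 ^ 2 * \<theta> (x + c) * \<theta> (x - c)) / (\<theta> x ^ 2 * \<theta> c ^ 2)"
    by (simp add: kronecker_phi_def power2_eq_square mult_ac)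
  also have "\<dots> = E' c - E' x"
    unfolding theta_fay_deriv2 DERIV_imp_deriv[OF E_has_field_derivative[OF assms(1)]]
      DERIV_imp_deriv[OF E_has_field_derivative[OF assms(2)]]
    using assms by (simp add: divide_simps; simp add: algebra_simps power2_eq_square)
  finally show ?thesis .
qed

text \<open>This is \<open>theta_fay_deriv\<close> at a = y, b = z, divided by the four theta values
  in the denominator.\<close>

lemma E_sum_eq:
  assumes "\<theta> x \<noteq> 0" "\<theta> y \<noteq> 0" "\<theta> z \<noteq> 0" "\<theta> (x + y + z) \<noteq> 0"
  shows "E x + E y + E z - E (x + y + z) =
    \<theta>' 0 * \<theta> (x + y) * \<theta> (x + z) * \<theta> (y + z) / (\<theta> x * \<theta> y * \<theta> z * \<theta> (x + y + z))"
  unfolding theta_fay_deriv eisenstein_E1_def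
  using assms by (simp add: divide_simps; simp add: algebra_simps power2_eq_square)

section \<open>The degenerate associative Yang-Baxter equation\<close>

lemma phi_minus_left: "\<phi> (- x) y = - \<phi> x (- y)"
  using phi_minus[of x "- y"] by simp

definition pair_R :: "complex \<Rightarrow> complex \<Rightarrow> complex \<Rightarrow> ('k \<Rightarrow> complex) \<Rightarrow> ('k \<Rightarrow> 'k \<Rightarrow> complex) \<Rightarrow> 'k \<Rightarrow> 'k \<Rightarrow> complex" where
  "pair_R h z1 z2 = pair_act (\<phi> h) (\<phi> (z1 - z2)) (\<phi> (z1 + h)) (\<phi> z2) (E h + E (z1 - z2) + E z2 - E (z1 + h))"

text \<open>The coefficient of $\hbar^0$ in the expansion of the $R$-matrix at $\hbar = 0$.\<close>

definition pair_r :: "complex \<Rightarrow> complex \<Rightarrow> ('k \<Rightarrow> complex) \<Rightarrow> ('k \<Rightarrow> 'k \<Rightarrow> complex) \<Rightarrow> 'k \<Rightarrow> 'k \<Rightarrow> complex" where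
  "pair_r z1 z2 = pair_act E (\<phi> (z1 - z2)) (\<phi> z1) (\<phi> z2) (E (z1 - z2) + E z2 - E z1)"

text \<open>The derivative of the $R$-matrix along \<open>(h + t, z1 - t, z2 - t)\<close>.  The plain derivative in \<open>h\<close> does not
  fit into the degenerate Yang-Baxter equation, since the $R$-matrix depends on more than \<open>z1 - z2\<close>.\<close>

definition pair_dR :: "complex \<Rightarrow> complex \<Rightarrow> ('k \<Rightarrow> complex) \<Rightarrow> ('k \<Rightarrow> 'k \<Rightarrow> complex) \<Rightarrow> 'k \<Rightarrow> 'k \<Rightarrow> complex" where
  "pair_dR h z2 = pair_act (\<phi>' h) (\<lambda>_. 0) (\<lambda>_. 0) (\<lambda>v. - \<phi>' z2 v) (E' h - E' z2)"

text \<open>Here and in the two lemmas after it, sums and differences of arguments are separate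
  variables, so that the instances below can use atomic names such as \<open>z12\<close> and
  \<open>s1\<close>.\<close>

lemma phi_fay_shift:
  assumes "y + w = x" "u + v = t"
    and "\<theta> x \<noteq> 0" "\<theta> y \<noteq> 0" "\<theta> u \<noteq> 0" "\<theta> v \<noteq> 0" "\<theta> w \<noteq> 0" "\<theta> t \<noteq> 0"
  shows "\<phi> x u * \<phi> y v = \<phi> w u * \<phi> y t - \<phi> w (- v) * \<phi> x t"
proof -
  have "x - y = w" "y - x = - w"
    using assms(1) by auto
  then show ?thesis
    using phi_fay[of x y u v] assms(2-) phi_minus_left[of w v] by simp
qed

lemma phi_mult_same_right_shift:
  assumes "x + y = s" "\<theta> x \<noteq> 0" "\<theta> y \<noteq> 0" "\<theta> c \<noteq> 0" "\<theta> s \<noteq> 0"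
  shows "\<phi> x c * \<phi> y c = \<phi> s c * (E x + E y - E s + E c) - \<phi>' s c"
  using phi_mult_same_right[of x y c] assms by simp

lemma phi_mult_same_right_diff_shift:
  assumes "x + y = s" "x' + y' = s"
    and "\<theta> x \<noteq> 0" "\<theta> y \<noteq> 0" "\<theta> x' \<noteq> 0" "\<theta> y' \<noteq> 0" "\<theta> c \<noteq> 0" "\<theta> s \<noteq> 0"
  shows "\<phi> x c * \<phi> y c - \<phi> x' c * \<phi> y' c = \<phi> s c * (E x + E y - E x' - E y')"
  using phi_mult_same_right_diff[of x y x' y' c] assms by simp

text \<open>\<open>E_sum_eq\<close> at h, z1 - z2, z2. The extra factor is a gauge factor g(z1) /
  g(z2) with g(z) = \<theta>(z) / \<theta>(z + h), so it telescopes in products.\<close>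

lemma diag_eq_gauged_phi:
  assumes "\<theta> h \<noteq> 0" "\<theta> z1 \<noteq> 0" "\<theta> z2 \<noteq> 0" "\<theta> (z1 - z2) \<noteq> 0" "\<theta> (z1 + h) \<noteq> 0"
  shows "E h + E (z1 - z2) + E z2 - E (z1 + h)
           = \<phi> h (z1 - z2) * (\<theta> z1 * \<theta> (z2 + h) / (\<theta> (z1 + h) * \<theta> z2))"
proof -
  have *: "h + (z1 - z2) + z2 = z1 + h" "z1 - z2 + z2 = z1" "h + z2 = z2 + h"
    by simp_all
  show ?thesis
    unfolding E_sum_eq[of h "z1 - z2" z2, unfolded *, OF assms(1,4,3,5)]
    by (simp add: kronecker_phi_def mult_ac)
qed

text \<open>The arguments z1 and -z3 have the same sum as z1 - z2 and z2 - z3, so the two products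
  of \<phi> differ by a multiple of \<open>\<phi> h (z1 - z3)\<close>. The gauge factor turns
  \<open>\<phi> h z1\<close> into \<open>\<phi> h z3\<close>, and \<open>phi_mult_opposite\<close>
  gives the derivative term.\<close>

lemma diag_yang_baxter:
  assumes "\<theta> h \<noteq> 0" "\<theta> z1 \<noteq> 0" "\<theta> z2 \<noteq> 0" "\<theta> z3 \<noteq> 0"
    and "\<theta> (z1 + h) \<noteq> 0" "\<theta> (z2 + h) \<noteq> 0"
    and "\<theta> (z1 - z2) \<noteq> 0" "\<theta> (z2 - z3) \<noteq> 0" "\<theta> (z1 - z3) \<noteq> 0"
  shows "(E h + E (z1 - z2) + E z2 - E (z1 + h)) * (E h + E (z2 - z3) + E z3 - E (z2 + h))
       = (E h + E (z1 - z3) + E z3 - E (z1 + h)) * (E (z1 - z2) + E (z2 - z3) + E z3 - E z1)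
         - (E' h - E' z3)"
proof -
  define g where "g = \<theta> z1 * \<theta> (z3 + h) / (\<theta> (z1 + h) * \<theta> z3)"
  have "\<phi> (z1 - z2) h * \<phi> (z2 - z3) h - \<phi> z1 h * \<phi> (- z3) h
      = \<phi> (z1 - z3) h * (E (z1 - z2) + E (z2 - z3) - E z1 - E (- z3))"
    by (rule phi_mult_same_right_diff_shift) (use assms in simp_all)
  then have phi_eq: "\<phi> h (z1 - z2) * \<phi> h (z2 - z3) =
      \<phi> h z1 * \<phi> h (- z3) + \<phi> h (z1 - z3) * (E (z1 - z2) + E (z2 - z3) + E z3 - E z1)"
    by (simp add: phi_commute[of h] algebra_simps)
  have "(E h + E (z1 - z2) + E z2 - E (z1 + h)) * (E h + E (z2 - z3) + E z3 - E (z2 + h))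
      = g * (\<phi> h (z1 - z2) * \<phi> h (z2 - z3))"
    unfolding diag_eq_gauged_phi[OF assms(1,2,3,7,5)] diag_eq_gauged_phi[OF assms(1,3,4,8,6)] g_def
    using assms by (simp add: field_simps)
  also have "\<dots> = g * (\<phi> h z1 * \<phi> h (- z3) + \<phi> h (z1 - z3) * (E (z1 - z2) + E (z2 - z3) + E z3 - E z1))"
    by (simp only: phi_eq)
  also have "\<dots> = g * \<phi> h z1 * \<phi> h (- z3) + \<phi> h (z1 - z3) * g * (E (z1 - z2) + E (z2 - z3) + E z3 - E z1)"
    by (simp add: algebra_simps)
  also have "g * \<phi> h z1 = \<phi> h z3"
    using assms by (simp add: g_def kronecker_phi_def add.commute field_simps)
  also have "\<phi> h (z1 - z3) * g = E h + E (z1 - z3) + E z3 - E (z1 + h)"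
    using assms by (simp add: diag_eq_gauged_phi g_def)
  finally show ?thesis
    using assms by (simp add: phi_mult_opposite)
qed

text \<open>The two gauge factors are reciprocal, which leaves the product formula for opposite
  arguments.\<close>

lemma diag_unitarity:
  assumes "\<theta> h \<noteq> 0" "\<theta> z1 \<noteq> 0" "\<theta> z2 \<noteq> 0" "\<theta> (z1 + h) \<noteq> 0" "\<theta> (z2 + h) \<noteq> 0" "\<theta> (z1 - z2) \<noteq> 0"
  shows "(E h + E (z1 - z2) + E z2 - E (z1 + h)) * (E h + E (z2 - z1) + E z1 - E (z2 + h))
       = E' (z1 - z2) - E' h"
proof -
  have z21: "\<theta> (z2 - z1) \<noteq> 0"
    using assms theta_diff_eq_0_commute by blast
  have "(E h + E (z1 - z2) + E z2 - E (z1 + h)) * (E h + E (z2 - z1) + E z1 - E (z2 + h))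
      = \<phi> h (z1 - z2) * \<phi> h (- (z1 - z2))"
    unfolding diag_eq_gauged_phi[OF assms(1,2,3,6,4)] diag_eq_gauged_phi[OF assms(1,3,2) z21 assms(5)]
    using assms by (simp add: field_simps)
  then show ?thesis
    using phi_mult_opposite[of h "z1 - z2"] assms by simp
qed

text \<open>Split by coincidences among \<open>i\<close>, \<open>j\<close>, \<open>k\<close> and
  compare the coefficients of the values of \<open>f\<close>. For distinct indices each coefficient
  vanishes by the Fay identity or its limit \<open>phi_mult_same_left\<close>; when two coincide, by
  products with common or opposite arguments; when all coincide, by
  \<open>diag_yang_baxter\<close>.\<close>

lemma pair_R_yang_baxter:
  assumes "\<theta> h \<noteq> 0" "\<theta> z1 \<noteq> 0" "\<theta> z2 \<noteq> 0" "\<theta> z3 \<noteq> 0"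
    and "\<theta> (z1 + h) \<noteq> 0" "\<theta> (z2 + h) \<noteq> 0"
    and "\<theta> (z1 - z2) \<noteq> 0" "\<theta> (z2 - z3) \<noteq> 0" "\<theta> (z1 - z3) \<noteq> 0"
    and u: "\<And>i j. i \<noteq> j \<Longrightarrow> \<theta> (u i - u j) \<noteq> 0"
  shows "pair_R h z1 z2 u (\<lambda>i j. pair_R h z2 z3 u (\<lambda>j k. f i j k) j k) i j =
      pair_R h z1 z3 u (\<lambda>i k. pair_r z1 z2 u (\<lambda>i j. f i j k) i j) i k
    + pair_r z2 z3 u (\<lambda>j k. pair_R h z1 z3 u (\<lambda>i k. f i j k) i k) j k
    - pair_dR h z3 u (\<lambda>i k. f i j k) i k" (is "?L = ?R")
proof -
  define z12 z23 z13 s1 s2 where "z12 = z1 - z2" and "z23 = z2 - z3" and "z13 = z1 - z3"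
    and "s1 = z1 + h" and "s2 = z2 + h"
  note z_defs = z12_def z23_def z13_def s1_def s2_def
  note nz = assms(1-9)[folded z_defs]
  have sums: "z1 - z2 = z12" "z2 - z3 = z23" "z1 - z3 = z13" "z12 + z23 = z13" "z13 - z12 = z23"
    "z13 - z23 = z12" "z1 - z13 = z3" "z2 - z23 = z3" "z23 + z3 = z2" "z3 + z13 = z1"
    "z2 + h = s2" "s1 - z12 = s2" "s1 - s2 = z12" "s1 - z1 = h" "s2 - z2 = h" "s2 - h = z2" "s1 - h = z1"
    "z12 + s2 = s1" "s2 + z12 = s1" "h + z1 = s1" "z3 + z23 = z2"
    by (simp_all add: z_defs)
  consider (dist) "i \<noteq> j" "j \<noteq> k" "i \<noteq> k" | (iik) "i = j" "j \<noteq> k" | (iji) "i = k" "j \<noteq> k"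
    | (ijj) "j = k" "i \<noteq> j" | (iii) "i = j" "j = k"
    by blast
  then show ?thesis
  proof cases
    case dist
    define a b t where "a = u j - u i" and "b = u k - u j" and "t = u k - u i"
    have us: "u j - u i = a" "u i - u j = - a" "u k - u j = b" "u j - u k = - b" "u k - u i = t" "u i - u k = - t"
      by (simp_all add: a_def b_def t_def)
    have nzu: "\<theta> a \<noteq> 0" "\<theta> b \<noteq> 0" "\<theta> t \<noteq> 0"
      using u dist by (auto simp: a_def b_def t_def)
    have abt: "t = a + b"
      by (simp add: a_def b_def t_def)
    have sum_eq: "- b - a = - t" "b - t = - a"
      by (simp_all add: abt)
    have 1: "\<phi> z3 (- b) * \<phi> z3 (- a) + \<phi> z3 (- t) * (E a + E b) + \<phi>' z3 (- t) = 0"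
      using phi_mult_same_left[of z3 "- b" "- a"] nz nzu
      by (simp add: sum_eq; simp add: algebra_simps)
    have 2: "\<phi> h a * \<phi> h b - \<phi> h t * (E a + E b) + \<phi>' h t = 0"
      using phi_mult_same_left[of h a b] nz nzu by (simp add: abt)
    have 3: "\<phi> z2 b * \<phi> z3 (- t) - \<phi> z23 b * \<phi> z3 (- a) + \<phi> z23 t * \<phi> z2 (- a) = 0"
      using phi_fay_shift[of z3 z23 z2 b "- t" "- a"] nz nzu by (simp add: sum_eq sums; simp add: algebra_simps)
    have 4: "\<phi> h a * \<phi> s2 b + \<phi> z2 (- a) * \<phi> s2 t - \<phi> z2 b * \<phi> h t = 0"
      using phi_fay_shift[of s2 "- z2" h a b t] nz nzu by (simp add: abt sums phi_minus_left; simp add: algebra_simps)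
    have 5: "\<phi> z13 t * \<phi> z1 (- b) + \<phi> z3 (- t) * \<phi> z1 a - \<phi> z3 (- b) * \<phi> z13 a = 0"
      using phi_fay_shift[of z1 "- z3" z13 t "- b" a] nz nzu by (simp add: abt sums phi_minus_left; simp add: algebra_simps)
    have 6: "\<phi> s1 a * \<phi> h b - \<phi> h t * \<phi> z1 a + \<phi> s1 t * \<phi> z1 (- b) = 0"
      using phi_fay_shift[of h z1 s1 a b t] nz nzu by (simp add: abt sums; simp add: algebra_simps)
    have 7: "\<phi> z13 t * \<phi> z12 (- b) - \<phi> z12 a * \<phi> z23 t + \<phi> z23 b * \<phi> z13 a = 0"
      using phi_fay_shift[of z12 z23 z13 t "- b" a] nz nzu by (simp add: abt sums; simp add: algebra_simps)
    have 8: "\<phi> s1 a * \<phi> s2 b - \<phi> z12 a * \<phi> s2 t + \<phi> s1 t * \<phi> z12 (- b) = 0"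
      using phi_fay_shift[of s2 z12 s1 a b t] nz nzu by (simp add: abt sums; simp add: algebra_simps)
    have "?L - ?R =
        - (\<phi> z3 (- b) * \<phi> z3 (- a) + \<phi> z3 (- t) * (E a + E b) + \<phi>' z3 (- t)) * f i j i
      + (\<phi> h a * \<phi> h b - \<phi> h t * (E a + E b) + \<phi>' h t) * f i j k
      + (\<phi> z2 b * \<phi> z3 (- t) - \<phi> z23 b * \<phi> z3 (- a) + \<phi> z23 t * \<phi> z2 (- a)) * f i k i
      - (\<phi> h a * \<phi> s2 b + \<phi> z2 (- a) * \<phi> s2 t - \<phi> z2 b * \<phi> h t) * f i k k
      + (\<phi> z13 t * \<phi> z1 (- b) + \<phi> z3 (- t) * \<phi> z1 a - \<phi> z3 (- b) * \<phi> z13 a) * f j j i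
      - (\<phi> s1 a * \<phi> h b - \<phi> h t * \<phi> z1 a + \<phi> s1 t * \<phi> z1 (- b)) * f j j k
      - (\<phi> z13 t * \<phi> z12 (- b) - \<phi> z12 a * \<phi> z23 t + \<phi> z23 b * \<phi> z13 a) * f j k i
      + (\<phi> s1 a * \<phi> s2 b - \<phi> z12 a * \<phi> s2 t + \<phi> s1 t * \<phi> z12 (- b)) * f j k k"
      unfolding pair_R_def pair_r_def pair_dR_def pair_act_def z_defs[symmetric]
      using dist dist[symmetric] by (simp add: us algebra_simps)
    then show ?thesis
      unfolding 1 2 3 4 5 6 7 8 by simp
  next
    case iik
    define c where "c = u k - u i"
    have us: "u k - u i = c" "u i - u k = - c"
      by (simp_all add: c_def)
    have nzu: "\<theta> c \<noteq> 0"
      using u iik(2) by (simp add: c_def iik(1))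
    have 1: "\<phi> z13 c * \<phi> z1 (- c) + \<phi> z3 (- c) * (E z1 - E z13 - E z3 - E c) - \<phi>' z3 (- c) = 0"
      using phi_mult_same_right_shift[of "- z13" z1 z3 "- c"] nz nzu
      by (simp add: sums phi_minus_left; simp add: algebra_simps)
    have 2: "\<phi> h c * (E s1 - E z1 - E h + E c) + \<phi> s1 c * \<phi> z1 (- c) - \<phi>' h c = 0"
      using phi_mult_same_right_shift[of s1 "- z1" h c] nz nzu
      by (simp add: sums phi_minus_left; simp add: algebra_simps)
    have 3: "\<phi> z13 c * \<phi> z12 (- c) - \<phi> z2 c * \<phi> z3 (- c) + \<phi> z23 c * (E z13 - E z12 - E z2 + E z3) = 0"
      using phi_mult_same_right_diff_shift[of z13 "- z12" z23 z2 "- z3" c] nz nzu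
      by (simp add: sums phi_minus_left; simp add: algebra_simps)
    have 4: "\<phi> s1 c * \<phi> z12 (- c) + \<phi> z2 c * \<phi> h c + \<phi> s2 c * (E s1 - E z12 - E z2 - E h) = 0"
      using phi_mult_same_right_diff_shift[of s1 "- z12" s2 z2 h c] nz nzu
      by (simp add: sums phi_minus_left; simp add: algebra_simps)
    have "?L - ?R =
        (\<phi> z13 c * \<phi> z1 (- c) + \<phi> z3 (- c) * (E z1 - E z13 - E z3 - E c) - \<phi>' z3 (- c)) * f i i i
      - (\<phi> h c * (E s1 - E z1 - E h + E c) + \<phi> s1 c * \<phi> z1 (- c) - \<phi>' h c) * f i i k
      - (\<phi> z13 c * \<phi> z12 (- c) - \<phi> z2 c * \<phi> z3 (- c) + \<phi> z23 c * (E z13 - E z12 - E z2 + E z3)) * f i k i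
      + (\<phi> s1 c * \<phi> z12 (- c) + \<phi> z2 c * \<phi> h c + \<phi> s2 c * (E s1 - E z12 - E z2 - E h)) * f i k k"
      unfolding pair_R_def pair_r_def pair_dR_def pair_act_def z_defs[symmetric]
      using iik(2) iik(2)[symmetric] by (simp add: iik(1)[symmetric] us algebra_simps)
    then show ?thesis
      unfolding 1 2 3 4 by simp
  next
    case iji
    define c where "c = u j - u i"
    have us: "u j - u i = c" "u i - u j = - c"
      by (simp_all add: c_def)
    have nzu: "\<theta> c \<noteq> 0"
      using u iji by (auto simp: c_def)
    have 1: "\<phi> h c * \<phi> s2 (- c) + \<phi> z23 (- c) * \<phi> z3 (- c) - \<phi> z2 (- c) * (E h + E z23 + E z3 - E s2) = 0"
      using phi_mult_same_right_diff_shift[of "- h" s2 z2 z23 z3 "- c"] nz nzu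
      by (simp add: sums phi_minus_left; simp add: algebra_simps)
    have 2: "\<phi> h c * \<phi> h (- c) - \<phi> z3 c * \<phi> z3 (- c) + (E' h - E' z3) = 0"
      using nz nzu by (simp add: phi_mult_opposite)
    have 3: "\<phi> s1 c * \<phi> s2 (- c) - \<phi> z13 c * \<phi> z23 (- c) + \<phi> z12 c * (E s1 - E s2 - E z13 + E z23) = 0"
      using phi_mult_same_right_diff_shift[of s1 "- s2" z12 z13 "- z23" c] nz nzu
      by (simp add: sums phi_minus_left; simp add: algebra_simps)
    have 4: "\<phi> s1 c * \<phi> h (- c) + \<phi> z3 c * \<phi> z13 c + \<phi> z1 c * (E s1 - E h - E z3 - E z13) = 0"
      using phi_mult_same_right_diff_shift[of s1 "- h" z1 z3 z13 c] nz nzu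
      by (simp add: sums phi_minus_left; simp add: algebra_simps)
    have "?L - ?R =
      - (\<phi> h c * \<phi> s2 (- c) + \<phi> z23 (- c) * \<phi> z3 (- c) - \<phi> z2 (- c) * (E h + E z23 + E z3 - E s2)) * f i i i
      + (\<phi> h c * \<phi> h (- c) - \<phi> z3 c * \<phi> z3 (- c) + (E' h - E' z3)) * f i j i
      + (\<phi> s1 c * \<phi> s2 (- c) - \<phi> z13 c * \<phi> z23 (- c) + \<phi> z12 c * (E s1 - E s2 - E z13 + E z23)) * f j i i
      - (\<phi> s1 c * \<phi> h (- c) + \<phi> z3 c * \<phi> z13 c + \<phi> z1 c * (E s1 - E h - E z3 - E z13)) * f j j i"
      unfolding pair_R_def pair_r_def pair_dR_def pair_act_def z_defs[symmetric]
      using iji(2) iji(2)[symmetric] by (simp add: iji(1)[symmetric] us algebra_simps)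
    then show ?thesis
      unfolding 1 2 3 4 by simp
  next
    case ijj
    define c where "c = u j - u i"
    have us: "u j - u i = c" "u i - u j = - c"
      by (simp_all add: c_def)
    have nzu: "\<theta> c \<noteq> 0"
      using u ijj by (auto simp: c_def)
    have 1: "\<phi> z2 (- c) * \<phi> z23 c - \<phi> z3 (- c) * (E c + E z23 + E z3 - E z2) - \<phi>' z3 (- c) = 0"
      using phi_mult_same_right_shift[of z2 "- z23" z3 "- c"] nz nzu
      by (simp add: sums phi_minus_left; simp add: algebra_simps)
    have 2: "\<phi> h c * (E h + E z2 - E s2 - E c) - \<phi> z2 (- c) * \<phi> s2 c + \<phi>' h c = 0"
      using phi_mult_same_right_shift[of "- z2" s2 h c] nz nzu
      by (simp add: sums phi_minus_left; simp add: algebra_simps)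
    have 3: "\<phi> z12 c * \<phi> z23 c + \<phi> z3 (- c) * \<phi> z1 c - \<phi> z13 c * (E z12 + E z23 - E z1 + E z3) = 0"
      using phi_mult_same_right_diff_shift[of z12 z23 z13 z1 "- z3" c] nz nzu
      by (simp add: sums phi_minus_left; simp add: algebra_simps)
    have 4: "\<phi> z12 c * \<phi> s2 c - \<phi> h c * \<phi> z1 c - \<phi> s1 c * (E z12 + E s2 - E h - E z1) = 0"
      using phi_mult_same_right_diff_shift[of z12 s2 s1 h z1 c] nz nzu
      by (simp add: sums; simp add: algebra_simps)
    have "?L - ?R =
        (\<phi> z2 (- c) * \<phi> z23 c - \<phi> z3 (- c) * (E c + E z23 + E z3 - E z2) - \<phi>' z3 (- c)) * f i j i
      + (\<phi> h c * (E h + E z2 - E s2 - E c) - \<phi> z2 (- c) * \<phi> s2 c + \<phi>' h c) * f i j j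
      + (\<phi> z12 c * \<phi> z23 c + \<phi> z3 (- c) * \<phi> z1 c - \<phi> z13 c * (E z12 + E z23 - E z1 + E z3)) * f j j i
      - (\<phi> z12 c * \<phi> s2 c - \<phi> h c * \<phi> z1 c - \<phi> s1 c * (E z12 + E s2 - E h - E z1)) * f j j j"
      unfolding pair_R_def pair_r_def pair_dR_def pair_act_def z_defs[symmetric]
      using ijj(2) ijj(2)[symmetric] by (simp add: ijj(1)[symmetric] us algebra_simps)
    then show ?thesis
      unfolding 1 2 3 4 by simp
  next
    case iii
    then show ?thesis
      using arg_cong[OF diag_yang_baxter[OF assms(1-9)], of "\<lambda>t. t * f k k k"]
      unfolding pair_R_def pair_r_def pair_dR_def pair_act_def
      by (simp add: algebra_simps)
  qed
qed

text \<open>Off the diagonal the coefficient of \<open>f j i\<close> cancels by oddness of \<phi>,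
  that of \<open>f i j\<close> is the scalar, and those of \<open>f j j\<close> and
  \<open>f i i\<close> vanish because the compared products have equal argument sums.\<close>

lemma pair_R_unitarity:
  assumes "\<theta> h \<noteq> 0" "\<theta> z1 \<noteq> 0" "\<theta> z2 \<noteq> 0" "\<theta> (z1 + h) \<noteq> 0" "\<theta> (z2 + h) \<noteq> 0" "\<theta> (z1 - z2) \<noteq> 0"
    and u: "\<And>i j. i \<noteq> j \<Longrightarrow> \<theta> (u i - u j) \<noteq> 0"
  shows "pair_R h z1 z2 u (\<lambda>i j. pair_R h z2 z1 u (\<lambda>j i. f i j) j i) i j = (E' (z1 - z2) - E' h) * f i j"
    (is "?L = ?R")
proof (cases "i = j")
  case True
  then show ?thesis
    using diag_unitarity[OF assms(1-6)] by (simp add: pair_R_def pair_act_def)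
next
  case False
  define z12 s1 s2 where "z12 = z1 - z2" and "s1 = z1 + h" and "s2 = z2 + h"
  have sums: "z1 - z2 = z12" "s2 - h = z2" "z1 - z12 = z2" "z12 + s2 = s1" "h + z1 = s1"
    by (simp_all add: z12_def s1_def s2_def)
  have z21: "z2 - z1 = - z12"
    by (simp add: z12_def)
  note z_defs = z12_def s1_def s2_def
  note nz = assms(1-6)[folded z_defs]
  define c where "c = u j - u i"
  have us: "u j - u i = c" "u i - u j = - c"
    by (simp_all add: c_def)
  have nzu: "\<theta> c \<noteq> 0"
    using u False by (auto simp: c_def)
  have 1: "\<phi> h c * \<phi> h (- c) - \<phi> z12 c * \<phi> z12 (- c) - (E' z12 - E' h) = 0"
    using nz nzu by (simp add: phi_mult_opposite)
  have "\<phi> z12 c * \<phi> s2 c - \<phi> h c * \<phi> z1 c = \<phi> s1 c * (E z12 + E s2 - E h - E z1)"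
    by (rule phi_mult_same_right_diff_shift) (simp_all only: sums nz nzu not_False_eq_True)
  then have 2: "\<phi> z12 c * \<phi> s2 c - \<phi> h c * \<phi> z1 c - \<phi> s1 c * (E z12 + E s2 - E h - E z1) = 0"
    by simp
  have 3: "\<phi> h c * \<phi> s2 (- c) - \<phi> z12 c * \<phi> z1 (- c) - \<phi> z2 (- c) * (E h - E s2 - E z12 + E z1) = 0"
    using phi_mult_same_right_diff_shift[of "- h" s2 z2 "- z12" z1 "- c"] nz nzu
    by (simp add: sums phi_minus_left; simp add: algebra_simps)
  have "?L - ?R =
      (\<phi> h c * \<phi> h (- c) - \<phi> z12 c * \<phi> z12 (- c) - (E' z12 - E' h)) * f i j
    - (\<phi> z12 c * \<phi> s2 c - \<phi> h c * \<phi> z1 c - \<phi> s1 c * (E z12 + E s2 - E h - E z1)) * f j j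
    - (\<phi> h c * \<phi> s2 (- c) - \<phi> z12 c * \<phi> z1 (- c) - \<phi> z2 (- c) * (E h - E s2 - E z12 + E z1)) * f i i"
    unfolding pair_R_def pair_act_def z_defs[symmetric]
    using False False[symmetric] by (simp add: us z21 phi_minus_left algebra_simps)
  then show ?thesis
    unfolding 1 2 3 by (simp add: z_defs)
qed

text \<open>Exchanging the factors swaps the third and fourth coefficients, which enter with
  opposite signs; the others are odd.\<close>

lemma pair_r_antisym: "pair_r z2 z1 u (\<lambda>j i. f i j) j i = - pair_r z1 z2 u f i j"
proof -
  have "\<phi> (z2 - z1) (u i - u j) = - \<phi> (z1 - z2) (u j - u i)" "E (u i - u j) = - E (u j - u i)"
    "E (z2 - z1) = - E (z1 - z2)"
    using phi_minus[of "z1 - z2" "u j - u i"] E_minus[of "u j - u i"] E_minus[of "z1 - z2"]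
    by simp_all
  then show ?thesis
    by (simp add: pair_r_def pair_act_def algebra_simps)
qed

section \<open>Cyclic sums of R-matrices\<close>

text \<open>All entries of a row outside \<open>x\<close>, \<open>c\<close>, \<open>y\<close> stay
  fixed, so this is \<open>pair_R_yang_baxter\<close> for the delta function of a column in three
  indices.\<close>

lemma pair_matrix_yang_baxter:
  fixes x c y :: "'n::finite" and u :: "'k::finite \<Rightarrow> complex"
  assumes "x \<noteq> c" "c \<noteq> y" "x \<noteq> y"
    and "\<theta> h \<noteq> 0" "\<theta> z1 \<noteq> 0" "\<theta> z2 \<noteq> 0" "\<theta> z3 \<noteq> 0"
    and "\<theta> (z1 + h) \<noteq> 0" "\<theta> (z2 + h) \<noteq> 0"
    and "\<theta> (z1 - z2) \<noteq> 0" "\<theta> (z2 - z3) \<noteq> 0" "\<theta> (z1 - z3) \<noteq> 0"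
    and "\<And>i j. i \<noteq> j \<Longrightarrow> \<theta> (u i - u j) \<noteq> 0"
  shows "pair_matrix x c (pair_R h z1 z2 u) ** pair_matrix c y (pair_R h z2 z3 u) =
      pair_matrix x y (pair_R h z1 z3 u) ** pair_matrix x c (pair_r z1 z2 u)
    + pair_matrix c y (pair_r z2 z3 u) ** pair_matrix x y (pair_R h z1 z3 u)
    - pair_matrix x y (pair_dR h z3 u)"
proof -
  note mult = pair_matrix_mult[of _ _ "\<phi> h" "\<phi> (za - zb)" "\<phi> (za + h)" "\<phi> zb"
      "E h + E (za - zb) + E zb - E (za + h)" for za zb, folded pair_R_def]
    pair_matrix_mult[of _ _ E "\<phi> (za - zb)" "\<phi> za" "\<phi> zb" "E (za - zb) + E zb - E za" for za zb,
      folded pair_r_def]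
  have upd: "p(y := k, x := i) = p(x := i, y := k)" "p(c := j, x := i) = p(x := i, c := j)"
    "p(y := k, c := j) = p(c := j, y := k)" "p(x := i, c := p c) = p(x := i)" for p :: "'n \<Rightarrow> 'k" and i j k
    using assms(1-3) by auto
  show ?thesis
    unfolding vec_eq_iff
  proof (intro allI)
    fix p q :: "'n \<Rightarrow> 'k"
    define f where "f i j k = (of_bool (p(x := i, c := j, y := k) = q) :: complex)" for i j k
    have 1: "(pair_matrix x c (pair_R h z1 z2 u) ** pair_matrix c y (pair_R h z2 z3 u)) $ p $ q
        = pair_R h z1 z2 u (\<lambda>i j. pair_R h z2 z3 u (\<lambda>j k. f i j k) j (p y)) (p x) (p c)"
      unfolding mult using assms(1-3) by (simp add: pair_matrix_def f_def)
    have 2: "(pair_matrix x y (pair_R h z1 z3 u) ** pair_matrix x c (pair_r z1 z2 u)) $ p $ q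
        = pair_R h z1 z3 u (\<lambda>i k. pair_r z1 z2 u (\<lambda>i j. f i j k) i (p c)) (p x) (p y)"
      unfolding mult using assms(1-3) by (simp add: pair_matrix_def f_def upd)
    have 3: "(pair_matrix c y (pair_r z2 z3 u) ** pair_matrix x y (pair_R h z1 z3 u)) $ p $ q
        = pair_r z2 z3 u (\<lambda>j k. pair_R h z1 z3 u (\<lambda>i k. f i j k) (p x) k) (p c) (p y)"
      unfolding mult using assms(1-3) by (simp add: pair_matrix_def f_def upd)
    have 4: "pair_matrix x y (pair_dR h z3 u) $ p $ q = pair_dR h z3 u (\<lambda>i k. f i (p c) k) (p x) (p y)"
      by (simp add: pair_matrix_def f_def upd)
    show "(pair_matrix x c (pair_R h z1 z2 u) ** pair_matrix c y (pair_R h z2 z3 u)) $ p $ q =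
     (pair_matrix x y (pair_R h z1 z3 u) ** pair_matrix x c (pair_r z1 z2 u)
    + pair_matrix c y (pair_r z2 z3 u) ** pair_matrix x y (pair_R h z1 z3 u)
    - pair_matrix x y (pair_dR h z3 u)) $ p $ q"
      using pair_R_yang_baxter[where u = u and f = f and i = "p x" and j = "p c" and k = "p y", OF assms(4-12)] assms(13)
      by (simp only: vector_add_component vector_minus_component 1 2 3 4 not_False_eq_True simp_thms)
  qed
qed

lemma pair_matrix_unitarity:
  fixes x y :: "'n::finite" and u :: "'k::finite \<Rightarrow> complex"
  assumes "x \<noteq> y" "\<theta> h \<noteq> 0" "\<theta> z1 \<noteq> 0" "\<theta> z2 \<noteq> 0" "\<theta> (z1 + h) \<noteq> 0" "\<theta> (z2 + h) \<noteq> 0" "\<theta> (z1 - z2) \<noteq> 0"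
    and "\<And>i j. i \<noteq> j \<Longrightarrow> \<theta> (u i - u j) \<noteq> 0"
  shows "pair_matrix x y (pair_R h z1 z2 u) ** pair_matrix y x (pair_R h z2 z1 u)
    = mat (E' (z1 - z2) - E' h)"
  unfolding vec_eq_iff
proof (intro allI)
  fix p q :: "'n \<Rightarrow> 'k"
  define f where "f i j = (of_bool (p(x := i, y := j) = q) :: complex)" for i j
  have upd: "p(y := j, x := i) = p(x := i, y := j)" for p :: "'n \<Rightarrow> 'k" and i j
    using assms(1) by auto
  have "(pair_matrix x y (pair_R h z1 z2 u) ** pair_matrix y x (pair_R h z2 z1 u)) $ p $ q
      = pair_R h z1 z2 u (\<lambda>i j. pair_R h z2 z1 u (\<lambda>j i. f i j) j i) (p x) (p y)"
    unfolding pair_R_def pair_matrix_mult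
    using assms(1) by (simp add: pair_matrix_def f_def upd)
  also have "\<dots> = (E' (z1 - z2) - E' h) * f (p x) (p y)"
    by (rule pair_R_unitarity) (use assms in auto)
  finally show "(pair_matrix x y (pair_R h z1 z2 u) ** pair_matrix y x (pair_R h z2 z1 u)) $ p $ q
      = mat (E' (z1 - z2) - E' h) $ p $ q"
    by (simp add: mat_def f_def)
qed

lemma pair_matrix_antisym:
  assumes "x \<noteq> y"
  shows "pair_matrix y x (pair_r z2 z1 u) = - pair_matrix x y (pair_r z1 z2 u)"
  using pair_r_antisym[of z2 z1 u "\<lambda>i j. of_bool (p(x := i, y := j) = q)" "p y" "p x" for p q] assms
  by (simp add: vec_eq_iff pair_matrix_def fun_upd_twist)

text \<open>Along the shift z1 - z2 and z1 + h are constant, so only the coefficients in h and z2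
  vary; this accounts for the zeros in \<open>pair_dR\<close>.\<close>

lemma pair_matrix_has_derivative:
  assumes "\<theta> h \<noteq> 0" "\<theta> z2 \<noteq> 0"
  shows "has_matrix_derivative (\<lambda>t. pair_matrix x y (pair_R (h + t) (z1 - t) (z2 - t) u))
           (pair_matrix x y (pair_dR h z2 u)) 0"
proof -
  have lin: "((\<lambda>t. h + t) has_field_derivative 1) (at 0)" "((\<lambda>t. z2 - t) has_field_derivative - 1) (at 0)"
    by (auto intro!: derivative_eq_intros)
  have E: "(E has_field_derivative E' x) (at x)" if "\<theta> x \<noteq> 0" for x
    using E_has_field_derivative[OF that] DERIV_imp_deriv by metis
  have h: "((\<lambda>t. \<phi> (h + t) v) has_field_derivative \<phi>' h v) (at 0)" for v
    using DERIV_chain2[OF _ lin(1), of "\<lambda>x. \<phi> x v" "\<phi>' h v"] phi_has_field_derivative(1)[OF assms(1), of v] by simp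
  have z2: "((\<lambda>t. \<phi> (z2 - t) v) has_field_derivative - \<phi>' z2 v) (at 0)" for v
    using DERIV_chain2[OF _ lin(2), of "\<lambda>x. \<phi> x v" "\<phi>' z2 v"] phi_has_field_derivative(1)[OF assms(2), of v] by simp
  have Eh: "((\<lambda>t. E (h + t)) has_field_derivative E' h) (at 0)"
    using DERIV_chain2[OF _ lin(1), of E "E' h"] E[OF assms(1)] by simp
  have Ez: "((\<lambda>t. E (z2 - t)) has_field_derivative - E' z2) (at 0)"
    using DERIV_chain2[OF _ lin(2), of E "E' z2"] E[OF assms(2)] by simp
  have eq: "pair_R (h + t) (z1 - t) (z2 - t) = pair_act (\<phi> (h + t)) (\<phi> (z1 - z2)) (\<phi> (z1 + h)) (\<phi> (z2 - t))
      (E (h + t) + E (z1 - z2) + E (z2 - t) - E (z1 + h))" for t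
    by (simp add: pair_R_def)
  have d: "((\<lambda>t. E (h + t) + E (z1 - z2) + E (z2 - t) - E (z1 + h)) has_field_derivative E' h - E' z2) (at 0)"
    by (rule derivative_eq_intros Eh Ez refl)+ simp
  show ?thesis
    unfolding has_matrix_derivative_def pair_matrix_def vec_lambda_beta eq pair_dR_def
    by (intro allI pair_act_has_field_derivative h z2 d DERIV_const)
qed

text \<open>In a given row and column at most one summand of each sum is nonzero. The deltas at the
  other positions merge with the column condition into \<open>p(a := i, b := j) = q\<close>.\<close>

lemma R_ACF_at_eq_pair_matrix:
  fixes z :: "complex^'n" and u :: "complex^'k" and a b :: 'n
  assumes "a \<noteq> b"
  shows "R_ACF_at \<tau> h z u a b = pair_matrix a b (pair_R h (z $ a) (z $ b) (($) u))"
proof -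
  have prod: "(\<Prod>c\<in>UNIV - {a, b}. (mat 1 :: complex^'k^'k) $ p c $ q c) = of_bool (\<forall>c\<in>UNIV - {a, b}. p c = q c)"
    for p q :: "'n \<Rightarrow> 'k"
    by (auto simp: mat_def intro!: prod.neutral)
  have S: "finite {(i, j). i \<noteq> (j :: 'k)}"
    by simp
  have R: "R_ACF \<tau> h z1 z2 u $ (i, j) $ (k, l)
      = pair_R h z1 z2 (($) u) (\<lambda>i j. of_bool (i = k \<and> j = l)) i j" for z1 z2 i j k l
  proof -
    have 1: "(\<Sum>x\<in>{(i, j). i \<noteq> j}. (case x of (i', j') \<Rightarrow> F i' j' *\<^sub>m (matrix_unit i' i' \<otimes>\<^sub>K matrix_unit j' j')) $ (i, j) $ (k, l))
        = (if i \<noteq> j then F i j * of_bool (i = k \<and> j = l) else 0)" for F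
      by (subst sum_eq_single[OF S, of "(i, j)"])
         (auto simp: matrix_scale_def kronecker_prod_def matrix_unit_def split: if_splits)
    have 2: "(\<Sum>x\<in>{(i, j). i \<noteq> j}. (case x of (i', j') \<Rightarrow> F i' j' *\<^sub>m (matrix_unit i' j' \<otimes>\<^sub>K matrix_unit j' i')) $ (i, j) $ (k, l))
        = (if i \<noteq> j then F i j * of_bool (j = k \<and> i = l) else 0)" for F
      by (subst sum_eq_single[OF S, of "(i, j)"])
         (auto simp: matrix_scale_def kronecker_prod_def matrix_unit_def split: if_splits)
    have 3: "(\<Sum>x\<in>{(i, j). i \<noteq> j}. (case x of (i', j') \<Rightarrow> F i' j' *\<^sub>m (matrix_unit i' j' \<otimes>\<^sub>K matrix_unit j' j')) $ (i, j) $ (k, l))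
        = (if i \<noteq> j then F i j * of_bool (j = k \<and> j = l) else 0)" for F
      by (subst sum_eq_single[OF S, of "(i, j)"])
         (auto simp: matrix_scale_def kronecker_prod_def matrix_unit_def split: if_splits)
    have 4: "(\<Sum>x\<in>{(i, j). i \<noteq> j}. (case x of (i', j') \<Rightarrow> F i' j' *\<^sub>m (matrix_unit j' j' \<otimes>\<^sub>K matrix_unit i' j')) $ (i, j) $ (k, l))
        = (if i \<noteq> j then F j i * of_bool (i = k \<and> i = l) else 0)" for F
      by (subst sum_eq_single[OF S, of "(j, i)"])
         (auto simp: matrix_scale_def kronecker_prod_def matrix_unit_def split: if_splits)
    have 5: "(c *\<^sub>m (\<Sum>i'\<in>UNIV. matrix_unit i' i' \<otimes>\<^sub>K matrix_unit i' i')) $ (i, j) $ (k, l)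
        = (if i = j then c * of_bool (i = k \<and> j = l) else 0)" for c
    proof -
      have "(\<Sum>i'\<in>UNIV. (matrix_unit i' i' \<otimes>\<^sub>K matrix_unit i' i') $ (i, j) $ (k, l))
        = (if i = j then of_bool (i = k \<and> j = l) else 0)"
        by (subst sum_eq_single[of _ i]) (auto simp: kronecker_prod_def matrix_unit_def split: if_splits)
      then show ?thesis
        by (simp add: matrix_scale_def)
    qed
    show ?thesis
      unfolding R_ACF_def vector_add_component vector_minus_component sum_component 1 2 3 4 5
      by (simp add: pair_R_def pair_act_def)
  qed
  have upd: "p(a := i, b := j) = q \<longleftrightarrow> i = q a \<and> j = q b \<and> (\<forall>c\<in>UNIV - {a, b}. p c = q c)"
    for p q :: "'n \<Rightarrow> 'k" and i j
    using assms by (auto simp: fun_eq_iff)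
  have mult: "pair_R h z1 z2 v (\<lambda>i j. of_bool (Q i j)) i j * of_bool X
      = pair_R h z1 z2 v (\<lambda>i j. of_bool (Q i j \<and> X)) i j"
    for z1 z2 and v :: "'k \<Rightarrow> complex" and Q X i j
    by (cases X) (simp_all add: pair_R_def pair_act_def)
  show ?thesis
    unfolding R_ACF_at_def place2_def pair_matrix_def R prod upd mult conj_assoc ..
qed

text \<open>The part of \<open>R_ACF_regular\<close> that changes along the shift; the condition on
  \<open>u\<close> is kept separate.\<close>

definition regular :: "complex \<Rightarrow> ('n \<Rightarrow> complex) \<Rightarrow> bool" where
  "regular h z \<longleftrightarrow> \<theta> h \<noteq> 0 \<and> (\<forall>c. \<theta> (z c) \<noteq> 0 \<and> \<theta> (z c + h) \<noteq> 0)
     \<and> (\<forall>c d. c \<noteq> d \<longrightarrow> \<theta> (z c - z d) \<noteq> 0)"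

definition R_at :: "complex \<Rightarrow> ('n \<Rightarrow> complex) \<Rightarrow> ('k \<Rightarrow> complex) \<Rightarrow> 'n \<Rightarrow> 'n
    \<Rightarrow> complex^('n::finite \<Rightarrow> 'k::finite)^('n \<Rightarrow> 'k)" where
  "R_at h z u x y = pair_matrix x y (pair_R h (z x) (z y) u)"

definition dR_at :: "complex \<Rightarrow> ('n \<Rightarrow> complex) \<Rightarrow> ('k \<Rightarrow> complex) \<Rightarrow> 'n \<Rightarrow> 'n
    \<Rightarrow> complex^('n::finite \<Rightarrow> 'k::finite)^('n \<Rightarrow> 'k)" where
  "dR_at h z u x y = pair_matrix x y (pair_dR h (z y) u)"

text \<open>The set \<open>S\<close> need not contain all other positions, which makes induction on
  its size possible.\<close>

definition cyclic_sum :: "complex \<Rightarrow> ('n \<Rightarrow> complex) \<Rightarrow> ('k \<Rightarrow> complex) \<Rightarrow> 'n \<Rightarrow> 'n set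
    \<Rightarrow> complex^('n::finite \<Rightarrow> 'k::finite)^('n \<Rightarrow> 'k)" where
  "cyclic_sum h z u a S = (\<Sum>xs | distinct xs \<and> set xs = S. path_prod (R_at h z u) (a # xs @ [a]))"

lemma theta_open: "open {x. \<theta> x \<noteq> 0}"
proof -
  have "continuous_on UNIV \<theta>"
    by (intro holomorphic_on_imp_continuous_on vartheta_holomorphic Im_pos)
  then show ?thesis
    by (intro open_Collect_neq continuous_intros)
qed

text \<open>z c + h and z c - z d are invariant, so only h + t and z c - t need continuity. This
  makes scalar formulas available near 0, ready to be differentiated.\<close>

lemma eventually_regular_shift:
  fixes z :: "'n::finite \<Rightarrow> complex"
  assumes "regular h z"
  shows "\<forall>\<^sub>F t in nhds 0. regular (h + t) (\<lambda>c. z c - t)"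
proof -
  have cont: "isCont \<theta> x" for x
    using theta_has_field_derivative DERIV_isCont by blast
  have "((\<lambda>t. \<theta> (h + t)) \<longlongrightarrow> \<theta> (h + 0)) (nhds 0)"
    by (intro isCont_tendsto_compose[OF cont] tendsto_intros filterlim_ident)
  then have h: "\<forall>\<^sub>F t in nhds 0. \<theta> (h + t) \<noteq> 0"
    using assms by (intro tendsto_imp_eventually_ne) (auto simp: regular_def)
  have "\<forall>\<^sub>F t in nhds 0. \<theta> (z c - t) \<noteq> 0" for c
  proof -
    have "((\<lambda>t. \<theta> (z c - t)) \<longlongrightarrow> \<theta> (z c - 0)) (nhds 0)"
      by (intro isCont_tendsto_compose[OF cont] tendsto_intros filterlim_ident)
    then show ?thesis
      using assms by (intro tendsto_imp_eventually_ne) (auto simp: regular_def)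
  qed
  then have "\<forall>\<^sub>F t in nhds 0. \<forall>c. \<theta> (z c - t) \<noteq> 0"
    by (simp add: eventually_all_finite)
  with h show ?thesis
    by eventually_elim (use assms in \<open>simp add: regular_def\<close>)
qed

lemma cyclic_sum_insert:
  fixes z :: "'n::finite \<Rightarrow> complex" and u :: "'k::finite \<Rightarrow> complex"
  assumes reg: "regular h z" and u: "\<And>i j. i \<noteq> j \<Longrightarrow> \<theta> (u i - u j) \<noteq> 0"
    and S: "a \<notin> S" "c \<notin> S" "c \<noteq> a" "S \<noteq> {}"
    and scalar: "\<forall>\<^sub>F t in nhds 0. cyclic_sum (h + t) (\<lambda>x. z x - t) u a S = mat (g t)"
    and g': "(g has_field_derivative g') (at 0)"
  shows "cyclic_sum h z u a (insert c S) = mat (- g')"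
proof -
  define s where "s v = pair_matrix c v (pair_r (z c) (z v) u)" for v
  define P where "P = path_prod (R_at h z u)"
  define D where "D = path_deriv (R_at h z u) (dR_at h z u)"
  define Ord where "Ord = {xs. distinct xs \<and> set xs = S}"
  note reg' = reg[unfolded regular_def]
  have edge: "R_at h z u x c ** R_at h z u c y = s y ** R_at h z u x y - R_at h z u x y ** s x - dR_at h z u x y"
    if "x \<noteq> y" "x \<noteq> c" "y \<noteq> c" for x y
  proof -
    \<comment> \<open>Skew-symmetry expresses both r-terms through \<open>s\<close>, giving the
      difference that \<open>edge\<close> requires.\<close>
    have "pair_matrix x c (pair_r (z x) (z c) u) = - s x"
      using that unfolding s_def by (intro pair_matrix_antisym) auto
    moreover have "A ** - B = - (A ** B)" for A B :: "complex^('n \<Rightarrow> 'k)^('n \<Rightarrow> 'k)"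
      by (simp add: matrix_matrix_mult_def vec_eq_iff sum_negf)
    moreover have "R_at h z u x c ** R_at h z u c y =
        R_at h z u x y ** pair_matrix x c (pair_r (z x) (z c) u) + s y ** R_at h z u x y - dR_at h z u x y"
      unfolding R_at_def s_def dR_at_def
      using that reg' u by (intro pair_matrix_yang_baxter) auto
    ultimately show ?thesis
      by simp
  qed
  have commute: "R_at h z u x y ** s v = s v ** R_at h z u x y"
    if "x \<noteq> c" "y \<noteq> c" "v \<noteq> x" "v \<noteq> y" for x y v
    unfolding R_at_def s_def pair_R_def pair_r_def
    using that by (intro pair_matrix_commute) auto
  have Ord: "xs \<noteq> []" "distinct (a # xs)" "c \<notin> set (a # xs)" "set xs = S"
    "successively (\<noteq>) (a # xs @ [a])" if "xs \<in> Ord" for xs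
  proof -
    show *: "xs \<noteq> []" "distinct (a # xs)" "c \<notin> set (a # xs)" "set xs = S"
      using that S by (auto simp: Ord_def)
    show "successively (\<noteq>) (a # xs @ [a])"
      using * by (intro successively_cycle) auto
  qed
  have "cyclic_sum h z u a (insert c S) = (\<Sum>xs\<in>Ord. insertion_sum (R_at h z u) c (a # xs @ [a]))"
    unfolding cyclic_sum_def Ord_def
    by (subst sum_orderings_insert) (use S in \<open>simp_all flip: insertion_sum_eq\<close>)
  also have "\<dots> = (\<Sum>xs\<in>Ord. (\<Sum>v\<in>S. s v) ** P (a # xs @ [a]) - P (a # xs @ [a]) ** (\<Sum>v\<in>S. s v)
      - D (a # xs @ [a]))"
    using Ord unfolding P_def D_def
    by (intro sum.cong refl) (simp add: insertion_sum_closed[where R' = "dR_at h z u" and s = s] edge commute)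
  also have "\<dots> = (\<Sum>v\<in>S. s v) ** cyclic_sum h z u a S - cyclic_sum h z u a S ** (\<Sum>v\<in>S. s v)
      - (\<Sum>xs\<in>Ord. D (a # xs @ [a]))"
    unfolding cyclic_sum_def P_def Ord_def
    by (simp only: sum_subtractf matrix_sum_ldistrib[of "\<Sum>v\<in>S. s v"] matrix_sum_rdistrib[where C = "\<Sum>v\<in>S. s v"])
  also have "cyclic_sum h z u a S = mat (g 0)"
    using eventually_nhds_x_imp_x[OF scalar] by simp
  \<comment> \<open>Scalar matrices are central, so the commutator disappears.\<close>
  also have "(\<Sum>v\<in>S. s v) ** mat (g 0) = mat (g 0) ** (\<Sum>v\<in>S. s v)"
    by (simp add: matrix_matrix_mult_def mat_def vec_eq_iff if_distrib[of "\<lambda>t. t * _"]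
        if_distrib[of "\<lambda>t. _ * t"] mult.commute cong: if_cong)
  \<comment> \<open>By the Leibniz rule this is the derivative at t = 0 of the shifted cyclic sum,
    which equals \<open>mat (g t)\<close> near 0.\<close>
  also have "(\<Sum>xs\<in>Ord. D (a # xs @ [a])) = mat g'"
  proof -
    have deriv: "has_matrix_derivative (\<lambda>t. cyclic_sum (h + t) (\<lambda>x. z x - t) u a S)
        (\<Sum>xs\<in>Ord. D (a # xs @ [a])) 0"
      unfolding cyclic_sum_def Ord_def[symmetric] D_def
    proof (intro has_matrix_derivative_sum)
      fix xs assume xs: "xs \<in> Ord"
      have "has_matrix_derivative (\<lambda>t. R_at (h + t) (\<lambda>x. z x - t) u x y) (dR_at h z u x y) 0" for x y
        unfolding R_at_def dR_at_def using reg' by (intro pair_matrix_has_derivative) auto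
      from has_matrix_derivative_path_prod[OF this Ord(5)[OF xs]]
      show "has_matrix_derivative (\<lambda>t. path_prod (R_at (h + t) (\<lambda>x. z x - t) u) (a # xs @ [a]))
          (path_deriv (R_at h z u) (dR_at h z u) (a # xs @ [a])) 0"
        by simp
    qed
    have "(\<Sum>xs\<in>Ord. D (a # xs @ [a])) $ p $ q = mat g' $ p $ q" for p q
    proof (rule DERIV_unique)
      show "((\<lambda>t. cyclic_sum (h + t) (\<lambda>x. z x - t) u a S $ p $ q)
          has_field_derivative (\<Sum>xs\<in>Ord. D (a # xs @ [a])) $ p $ q) (at 0)"
        using deriv by (simp add: has_matrix_derivative_def)
      have 1: "((\<lambda>t. mat (g t) $ p $ q) has_field_derivative mat g' $ p $ q) (at 0)"
        using g' by (simp add: mat_def)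
      have 2: "\<forall>\<^sub>F t in nhds 0. cyclic_sum (h + t) (\<lambda>x. z x - t) u a S $ p $ q = mat (g t) $ p $ q"
        using scalar by eventually_elim simp
      show "((\<lambda>t. cyclic_sum (h + t) (\<lambda>x. z x - t) u a S $ p $ q)
          has_field_derivative mat g' $ p $ q) (at 0)"
        by (rule DERIV_cong_ev[OF refl 2 refl, THEN iffD2, OF 1])
    qed
    then show ?thesis
      by (simp add: vec_eq_iff)
  qed
  finally show ?thesis
    by (simp add: mat_def vec_eq_iff)
qed

section \<open>Derivatives of the Weierstrass function and the induction over positions\<close>

lemma wp_holomorphic: "weierstrass_wp \<tau> holomorphic_on {x. \<theta> x \<noteq> 0}"
proof -
  have "E holomorphic_on {x. \<theta> x \<noteq> 0}"
    unfolding eisenstein_E1_def[abs_def]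
    by (intro holomorphic_intros holomorphic_deriv[OF vartheta_holomorphic[OF Im_pos, of UNIV], THEN holomorphic_on_subset]
        vartheta_holomorphic Im_pos) auto
  from this theta_open have "E' holomorphic_on {x. \<theta> x \<noteq> 0}"
    by (rule holomorphic_deriv)
  then show ?thesis
    unfolding weierstrass_wp_def[abs_def]
    by (intro holomorphic_on_add holomorphic_on_minus holomorphic_on_const)
qed

lemma higher_deriv_wp_shift:
  assumes "\<theta> h \<noteq> 0"
  shows "((\<lambda>t. (deriv ^^ m) (weierstrass_wp \<tau>) (h + t))
    has_field_derivative (deriv ^^ Suc m) (weierstrass_wp \<tau>) h) (at 0)"
proof -
  have "(deriv ^^ m) (weierstrass_wp \<tau>) holomorphic_on {x. \<theta> x \<noteq> 0}"
    by (rule holomorphic_higher_deriv[OF wp_holomorphic theta_open])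
  then have "((deriv ^^ m) (weierstrass_wp \<tau>) has_field_derivative
      deriv ((deriv ^^ m) (weierstrass_wp \<tau>)) h) (at h)"
    by (rule holomorphic_derivI[OF _ theta_open]) (use assms in simp)
  then show ?thesis
    using DERIV_shift[of "(deriv ^^ m) (weierstrass_wp \<tau>)" _ 0 h]
    by (simp add: add.commute)
qed

text \<open>Induction by \<open>cyclic_sum_insert\<close>, with \<open>h\<close> and
  \<open>z\<close> general because the hypothesis is used at shifted points. It starts at two
  elements: for one element the sum still contains \<wp>(z a - z b), which the first differentiation
  removes.\<close>

lemma cyclic_sum_eq:
  fixes z :: "'n::finite \<Rightarrow> complex" and u :: "'k::finite \<Rightarrow> complex"
  assumes u: "\<And>i j. i \<noteq> j \<Longrightarrow> \<theta> (u i - u j) \<noteq> 0"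
    and "regular h z" "a \<notin> S" "card S = m + 2"
  shows "cyclic_sum h z u a S = mat ((- 1) ^ Suc m * (deriv ^^ Suc m) (weierstrass_wp \<tau>) h)"
  using assms(2-)
proof (induction m arbitrary: S h z)
  case 0
  obtain b c where S: "S = {c, b}" "b \<noteq> c"
    using 0(3) by (auto simp: card_2_iff numeral_2_eq_2[symmetric])
  have "\<forall>\<^sub>F t in nhds 0. cyclic_sum (h + t) (\<lambda>x. z x - t) u a {b}
      = mat (weierstrass_wp \<tau> (h + t) - weierstrass_wp \<tau> (z a - z b))"
    using eventually_regular_shift[OF 0(1)]
  proof eventually_elim
    case (elim t)
    note reg = elim[unfolded regular_def]
    have "cyclic_sum (h + t) (\<lambda>x. z x - t) u a {b}
        = R_at (h + t) (\<lambda>x. z x - t) u a b ** R_at (h + t) (\<lambda>x. z x - t) u b a"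
    proof -
      have "{xs. distinct xs \<and> set xs = {b}} = {[b]}"
      proof (intro set_eqI iffI)
        fix xs assume "xs \<in> {xs. distinct xs \<and> set xs = {b}}"
        then show "xs \<in> {[b]}"
          using distinct_card[of xs] by (cases xs) (auto simp: subset_singleton_iff)
      qed simp
      then show ?thesis
        by (simp add: cyclic_sum_def)
    qed
    \<comment> \<open>The shift cancels in the difference of positions, so this term is constant in
      \<open>t\<close>; the additive constants of the two \<wp>-values cancel as well.\<close>
    also have "\<dots> = mat (E' ((z a - t) - (z b - t)) - E' (h + t))"
      unfolding R_at_def using reg S 0(2) u by (intro pair_matrix_unitarity) auto
    finally show ?case
      by (simp add: weierstrass_wp_def)
  qed
  moreover have "((\<lambda>t. weierstrass_wp \<tau> (h + t) - weierstrass_wp \<tau> (z a - z b))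
      has_field_derivative deriv (weierstrass_wp \<tau>) h) (at 0)"
    using higher_deriv_wp_shift[of h 0] 0(1)
    by (auto simp: regular_def intro!: derivative_eq_intros)
  ultimately have "cyclic_sum h z u a (insert c {b}) = mat (- deriv (weierstrass_wp \<tau>) h)"
    using 0 S u by (intro cyclic_sum_insert) auto
  then show ?case
    by (simp add: S)
next
  case (Suc m)
  from Suc.prems(3) have "card S = Suc (m + 2)"
    by simp
  then obtain c S' where S: "S = insert c S'" "c \<notin> S'" "card S' = m + 2"
    using card_eq_SucD by blast
  have "\<forall>\<^sub>F t in nhds 0. cyclic_sum (h + t) (\<lambda>x. z x - t) u a S'
      = mat ((- 1) ^ Suc m * (deriv ^^ Suc m) (weierstrass_wp \<tau>) (h + t))"
    using eventually_regular_shift[OF Suc.prems(1)]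
    by eventually_elim (use Suc.IH Suc.prems S in auto)
  moreover have "((\<lambda>t. (- 1) ^ Suc m * (deriv ^^ Suc m) (weierstrass_wp \<tau>) (h + t))
      has_field_derivative (- 1) ^ Suc m * (deriv ^^ Suc (Suc m)) (weierstrass_wp \<tau>) h) (at 0)"
    using Suc.prems(1) by (intro DERIV_cmult higher_deriv_wp_shift) (simp add: regular_def)
  ultimately have "cyclic_sum h z u a (insert c S')
      = mat (- ((- 1) ^ Suc m * (deriv ^^ Suc (Suc m)) (weierstrass_wp \<tau>) h))"
    using Suc.prems S u by (intro cyclic_sum_insert) auto
  then show ?case
    by (simp add: S)
qed

lemma R_ACF_cyclic_sum:
  fixes h :: complex
    and z :: "complex^'n"
    and u :: "complex^'k"
    and a :: 'n
  assumes "CARD('n) \<ge> 3"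
    and "R_ACF_regular \<tau> h z u"
  shows "(\<Sum>is\<in>{is. length is = CARD('n) - 1 \<and> distinct is \<and> set is \<subseteq> UNIV - {a}}.
            path_prod (R_ACF_at \<tau> h z u) (a # is @ [a]))
         = ((-1) ^ CARD('n) * (deriv ^^ (CARD('n) - 2)) (weierstrass_wp \<tau>) h)
             *\<^sub>m (mat 1 :: complex^('n \<Rightarrow> 'k)^('n \<Rightarrow> 'k))"
proof -
  obtain m where m: "CARD('n) = m + 3"
    using assms(1) by (metis add.commute le_Suc_ex)
  have card: "card (UNIV - {a}) = m + 2"
    using m by (simp add: card_Diff_singleton)
  \<comment> \<open>A distinct list of this length inside \<open>UNIV - {a}\<close> must exhaust it,
    by cardinality.\<close>
  have orderings: "{is. length is = CARD('n) - 1 \<and> distinct is \<and> set is \<subseteq> UNIV - {a}}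
      = {is. distinct is \<and> set is = UNIV - {a}}"
  proof (intro Collect_cong iffI conjI)
    fix xs :: "'n list"
    assume *: "length xs = CARD('n) - 1 \<and> distinct xs \<and> set xs \<subseteq> UNIV - {a}"
    then have "card (set xs) = card (UNIV - {a})"
      by (simp add: distinct_card card_Diff_singleton)
    with * show "set xs = UNIV - {a}"
      by (intro card_subset_eq) auto
  next
    fix xs :: "'n list"
    assume "distinct xs \<and> set xs = UNIV - {a}"
    then show "length xs = CARD('n) - 1"
      using distinct_card[of xs] by (simp add: card_Diff_singleton)
  qed auto
  \<comment> \<open>The two families agree only for distinct positions, hence the condition on
    neighbours in the path.\<close>
  have path: "path_prod (R_ACF_at \<tau> h z u) xs = path_prod (R_at h (($) z) (($) u)) xs"
    if "successively (\<noteq>) xs" for xs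
    using that
    by (induction xs rule: induct_list012) (simp_all add: R_ACF_at_eq_pair_matrix R_at_def)
  have ne: "UNIV - {a} \<noteq> {}"
  proof
    assume "UNIV - {a} = {}"
    then have "card (UNIV - {a}) = 0"
      by (simp only: card.empty)
    with card show False
      by simp
  qed
  have "(\<Sum>is | distinct is \<and> set is = UNIV - {a}. path_prod (R_ACF_at \<tau> h z u) (a # is @ [a]))
      = cyclic_sum h (($) z) (($) u) a (UNIV - {a})"
    unfolding cyclic_sum_def
  proof (intro sum.cong refl path)
    fix xs assume "xs \<in> {is. distinct is \<and> set is = UNIV - {a}}"
    moreover from this ne have "xs \<noteq> []"
      by (metis (mono_tags, lifting) list.set(1) mem_Collect_eq)
    ultimately show "successively (\<noteq>) (a # xs @ [a])"
      by (intro successively_cycle) auto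
  qed
  also have "\<dots> = mat ((- 1) ^ Suc m * (deriv ^^ Suc m) (weierstrass_wp \<tau>) h)"
    using assms(2) card
    by (intro cyclic_sum_eq) (auto simp: R_ACF_regular_def regular_def)
  finally show ?thesis
    unfolding orderings by (simp add: m matrix_scale_def mat_def vec_eq_iff power_add)
qed

end

theorem mainTheorem3:
  fixes \<tau> h :: complex
    and z :: "complex^'n"
    and u :: "complex^'k"
    and a :: 'n
  assumes "Im \<tau> > 0"
    and "CARD('n) \<ge> 3"
    and "R_ACF_regular \<tau> h z u"
  shows "(\<Sum>is\<in>{is. length is = CARD('n) - 1 \<and> distinct is \<and> set is \<subseteq> UNIV - {a}}.
            path_prod (R_ACF_at \<tau> h z u) (a # is @ [a]))
         = ((-1) ^ CARD('n) * (deriv ^^ (CARD('n) - 2)) (weierstrass_wp \<tau>) h)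
             *\<^sub>m (mat 1 :: complex^('n \<Rightarrow> 'k)^('n \<Rightarrow> 'k))"
  by (rule R_ACF_cyclic_sum[OF assms])

end
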